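(* Let $F:\mathbb{R}^n\rightrightarrows\mathbb{R}^n$ satisfy assumptions (F) and (H), let $\mathcal{K}\subset\mathbb{R}^n$ be closed, let $\mathcal{T}$ be the associated minimum time function, and let $x_0\in\mathcal{R}\setminus\mathcal{K}$. Let $\bar x:[0,\mathcal{T}(x_0)]\to\mathbb{R}^n$ be an optimal trajectory for $x_0$ and let $\bar p:[0,\mathcal{T}(x_0)]\to\mathbb{R}^n$ be an absolutely continuous arc such that $(\bar x,\bar p)$ is a solution of the system $$\dot x(s)=\nabla_pH(x(s),p(s)),\qquad -\dot p(s)\in\partial_xH(x(s),p(s)),\qquad\text{a.e. } s\in[0,\mathcal{T}(x_0)],$$ satisfying $\bar x(0)=x_0$ and $-\bar p(0)\in\partial^\infty\mathcal{T}(x_0)$. Then, for all $t\in[0,\mathcal{T}(x_0)]$, $$-\bar p(t)\in\partial^\infty\mathcal{T}(\bar x(t))\quad\text{and}\quad h(\bar x(t),-\bar p(t))=0.$$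
   Context: Assumption (F) on a multifunction $F:\mathbb{R}^n\rightrightarrows\mathbb{R}^n$: (F1) $F(x)$ is nonempty, convex and compact for each $x\in\mathbb{R}^n$; (F2) for each compact $Q\subset\mathbb{R}^n$ there is $L>0$ with $F(x)\subset F(y)+L|y-x|\bar{\mathbb{B}}$ for all $x,y\in Q$, where $\bar{\mathbb{B}}$ is the closed unit ball; (F3) there is $\gamma>0$ with $\max\{|v|:v\in F(x)\}\le\gamma(1+|x|)$ for all $x\in\mathbb{R}^n$. Hamiltonians: $H(x,p)=\max_{v\in F(x)}\langle v,p\rangle$ and $h(x,\zeta)=\min_{v\in F(x)}\langle v,\zeta\rangle$. $\nabla_pH$ is the partial gradient in $p$; $\partial_xH(x,p)$ is Clarke's generalized gradient of $x\mapsto H(x,p)$, i.e. for a locally Lipschitz $f$, $\partial f(x)=\mathrm{co}\{v:\exists y_i\to x,\ f \text{ differentiable at } y_i,\ \nabla f(y_i)\to v\}$. Assumption (H): for every $r>0$, (H1) there exists $c\ge0$ so that for every $p\in\mathbb{S}^{n-1}$ (the unit sphere) the mapping $x\mapsto H(x,p)$ is semiconvex with semiconvexity constant $c$; (H2) $\nabla_pH(x,p)$ exists and is Lipschitz in $x$ on $B(0,r)$, uniformly for $p\in\mathbb{R}^n\setminus\{0\}$. Here a function $g$ on an open set $\Omega$ is semiconvex with constant $c$ if it is continuous and $g(x+k)+g(x-k)-2g(x)\ge-c|k|^2$ whenever $[x-k,x+k]\subset\Omega$. A trajectory of $F$ starting at $x$ is an absolutely continuous $x(\cdot)$ on $[0,T]$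 with $\dot x(t)\in F(x(t))$ for a.e. $t$ and $x(0)=x$. The minimum time function $\mathcal{T}:\mathbb{R}^n\to[0,+\infty]$ associated with the closed target $\mathcal{K}$ is $\mathcal{T}(x)=0$ if $x\in\mathcal{K}$, and otherwise $\mathcal{T}(x)=\inf\{T>0:\text{there is a trajectory } x(\cdot) \text{ of } F \text{ with } x(0)=x,\ x(T)\in\mathcal{K}\}$, with $\inf\emptyset=+\infty$. The controllable set is $\mathcal{R}=\{x:\mathcal{T}(x)<+\infty\}$. An optimal trajectory for $x_0\in\mathcal{R}$ is a trajectory $\bar x$ of $F$ on $[0,\mathcal{T}(x_0)]$ with $\bar x(0)=x_0$ and $\bar x(\mathcal{T}(x_0))\in\mathcal{K}$. For a closed set $E$ and $x\in E$, the proximal normal cone $N^P_E(x)$ is the set of $v$ for which there is $\sigma\ge0$ with $\langle v,y-x\rangle\le\sigma|y-x|^2$ for all $y\in E$. The epigraph is $\mathrm{epi}(\mathcal{T})=\{(x,\beta)\in\mathbb{R}^n\times\mathbb{R}:\mathcal{T}(x)<+\infty,\ \beta\ge\mathcal{T}(x)\}$. The horizontal proximal subdifferential is $\partial^\infty\mathcal{T}(x)=\{v\in\mathbb{R}^n:(v,0)\in N^P_{\mathrm{epi}(\mathcal{T})}(x,\mathcal{T}(x))\}$. *)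

theory Defs
  imports "HOL-Analysis.Analysis"
begin

definition absolutely_continuous_on_interval ::
    "real \<Rightarrow> real \<Rightarrow> (real \<Rightarrow> 'a::real_normed_vector) \<Rightarrow> bool" where
  "absolutely_continuous_on_interval a b f \<longleftrightarrow>
     (\<forall>\<epsilon>>0. \<exists>\<delta>>0. \<forall>P :: (real \<times> real) set.
        finite P \<longrightarrow> (\<forall>(u, v)\<in>P. a \<le> u \<and> u \<le> v \<and> v \<le> b) \<longrightarrow>
        disjoint_family_on (\<lambda>(u, v). {u<..<v}) P \<longrightarrow>
        (\<Sum>(u, v)\<in>P. v - u) < \<delta> \<longrightarrow>
        (\<Sum>(u, v)\<in>P. norm (f v - f u)) < \<epsilon>)"

definition assumption_F :: "(real^'n \<Rightarrow> (real^'n) set) \<Rightarrow> bool" where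
  "assumption_F F \<longleftrightarrow>
     (\<forall>x. F x \<noteq> {} \<and> convex (F x) \<and> compact (F x)) \<and>
     (\<forall>Q. compact Q \<longrightarrow>
        (\<exists>L>0. \<forall>x\<in>Q. \<forall>y\<in>Q.
           F x \<subseteq> {v + (L * norm (y - x)) *\<^sub>R b |v b. v \<in> F y \<and> b \<in> cball 0 1})) \<and>
     (\<exists>\<gamma>>0. \<forall>x. \<forall>v\<in>F x. norm v \<le> \<gamma> * (1 + norm x))"

definition max_hamiltonian ::
    "(real^'n \<Rightarrow> (real^'n) set) \<Rightarrow> real^'n \<Rightarrow> real^'n \<Rightarrow> real" where
  "max_hamiltonian F x p = (SUP v\<in>F x. v \<bullet> p)"

definition min_hamiltonian ::
    "(real^'n \<Rightarrow> (real^'n) set) \<Rightarrow> real^'n \<Rightarrow> real^'n \<Rightarrow> real" where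
  "min_hamiltonian F x \<zeta> = (INF v\<in>F x. v \<bullet> \<zeta>)"

lemma max_hamiltonian_attained:
  assumes "assumption_F F"
  shows "\<exists>v\<in>F x. max_hamiltonian F x p = v \<bullet> p \<and> (\<forall>w\<in>F x. w \<bullet> p \<le> v \<bullet> p)"
proof -
  have "compact (F x)" "F x \<noteq> {}"
    using assms by (auto simp: assumption_F_def)
  moreover have "continuous_on (F x) (\<lambda>v. v \<bullet> p)"
    by (intro continuous_intros)
  ultimately obtain v where v: "v \<in> F x" "\<forall>w\<in>F x. w \<bullet> p \<le> v \<bullet> p"
    using continuous_attains_sup by metis
  then have "max_hamiltonian F x p = v \<bullet> p"
    unfolding max_hamiltonian_def by (intro cSup_eq_maximum) auto
  with v show ?thesis by blast
qed

lemma min_hamiltonian_attained: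
  assumes "assumption_F F"
  shows "\<exists>v\<in>F x. min_hamiltonian F x \<zeta> = v \<bullet> \<zeta> \<and> (\<forall>w\<in>F x. v \<bullet> \<zeta> \<le> w \<bullet> \<zeta>)"
proof -
  have "compact (F x)" "F x \<noteq> {}"
    using assms by (auto simp: assumption_F_def)
  moreover have "continuous_on (F x) (\<lambda>v. v \<bullet> \<zeta>)"
    by (intro continuous_intros)
  ultimately obtain v where v: "v \<in> F x" "\<forall>w\<in>F x. v \<bullet> \<zeta> \<le> w \<bullet> \<zeta>"
    using continuous_attains_inf by metis
  then have "min_hamiltonian F x \<zeta> = v \<bullet> \<zeta>"
    unfolding min_hamiltonian_def by (intro cInf_eq_minimum) auto
  with v show ?thesis by blast
qed

definition semiconvex_on :: "real \<Rightarrow> ('a::real_normed_vector) set \<Rightarrow> ('a \<Rightarrow> real) \<Rightarrow> bool" where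
  "semiconvex_on c \<Omega> g \<longleftrightarrow>
     continuous_on \<Omega> g \<and>
     (\<forall>x k. closed_segment (x - k) (x + k) \<subseteq> \<Omega> \<longrightarrow>
        g (x + k) + g (x - k) - 2 * g x \<ge> - c * (norm k)\<^sup>2)"

definition assumption_H :: "(real^'n \<Rightarrow> (real^'n) set) \<Rightarrow> bool" where
  "assumption_H F \<longleftrightarrow>
     (\<forall>r>0.
        (\<exists>c\<ge>0. \<forall>p\<in>sphere 0 1. semiconvex_on c (ball 0 r) (\<lambda>x. max_hamiltonian F x p)) \<and>
        (\<exists>L. \<forall>p. p \<noteq> 0 \<longrightarrow>
           (\<exists>G. (\<forall>x\<in>ball 0 r. GDERIV (max_hamiltonian F x) p :> G x) \<and>
                L-lipschitz_on (ball 0 r) G)))"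

definition clarke_gradient :: "('a::real_inner \<Rightarrow> real) \<Rightarrow> 'a \<Rightarrow> 'a set" where
  "clarke_gradient f x =
     convex hull {v. \<exists>(y :: nat \<Rightarrow> 'a) g.
        y \<longlonglongrightarrow> x \<and> (\<forall>i. GDERIV f (y i) :> g i) \<and> g \<longlonglongrightarrow> v}"

text \<open>Arcs on an interval are total functions on the reals of which only the values on
  the interval matter; derivatives are accordingly taken within the interval.\<close>

definition trajectory ::
    "(real^'n \<Rightarrow> (real^'n) set) \<Rightarrow> real \<Rightarrow> real^'n \<Rightarrow> (real \<Rightarrow> real^'n) \<Rightarrow> bool" where
  "trajectory F T x0 x \<longleftrightarrow>
     absolutely_continuous_on_interval 0 T x \<and> x 0 = x0 \<and>
     (AE t in lebesgue_on {0..T}.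
        \<exists>v\<in>F (x t). (x has_vector_derivative v) (at t within {0..T}))"

definition min_time :: "(real^'n \<Rightarrow> (real^'n) set) \<Rightarrow> (real^'n) set \<Rightarrow> real^'n \<Rightarrow> ereal" where
  "min_time F K x =
     (if x \<in> K then 0
      else Inf {ereal T |T. T > 0 \<and> (\<exists>y. trajectory F T x y \<and> y T \<in> K)})"

definition controllable_set ::
    "(real^'n \<Rightarrow> (real^'n) set) \<Rightarrow> (real^'n) set \<Rightarrow> (real^'n) set" where
  "controllable_set F K = {x. min_time F K x < \<infinity>}"

definition optimal_trajectory ::
    "(real^'n \<Rightarrow> (real^'n) set) \<Rightarrow> (real^'n) set \<Rightarrow> real^'n \<Rightarrow> (real \<Rightarrow> real^'n) \<Rightarrow> bool" where
  "optimal_trajectory F K x0 x \<longleftrightarrow>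
     x0 \<in> controllable_set F K \<and>
     trajectory F (real_of_ereal (min_time F K x0)) x0 x \<and>
     x (real_of_ereal (min_time F K x0)) \<in> K"

definition hamiltonian_solution ::
    "(real^'n \<Rightarrow> (real^'n) set) \<Rightarrow> real \<Rightarrow> (real \<Rightarrow> real^'n) \<Rightarrow> (real \<Rightarrow> real^'n) \<Rightarrow> bool" where
  "hamiltonian_solution F T x p \<longleftrightarrow>
     absolutely_continuous_on_interval 0 T x \<and> absolutely_continuous_on_interval 0 T p \<and>
     (AE s in lebesgue_on {0..T}.
        \<exists>dx dp. (x has_vector_derivative dx) (at s within {0..T}) \<and>
                (p has_vector_derivative dp) (at s within {0..T}) \<and>
                GDERIV (max_hamiltonian F (x s)) (p s) :> dx \<and>
                - dp \<in> clarke_gradient (\<lambda>y. max_hamiltonian F y (p s)) (x s))"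

text \<open>The normal cone at a point outside the set is empty.\<close>

definition proximal_normal_cone :: "('a::real_inner) set \<Rightarrow> 'a \<Rightarrow> 'a set" where
  "proximal_normal_cone E x =
     {v. x \<in> E \<and> (\<exists>\<sigma>\<ge>0. \<forall>y\<in>E. v \<bullet> (y - x) \<le> \<sigma> * (norm (y - x))\<^sup>2)}"

definition epi :: "('a \<Rightarrow> ereal) \<Rightarrow> ('a \<times> real) set" where
  "epi f = {(x, \<beta>). f x < \<infinity> \<and> f x \<le> ereal \<beta>}"

text \<open>Where \<open>f x = \<infinity>\<close>, \<open>(x, real_of_ereal (f x))\<close> lies outside the epigraph, so the
  subdifferential is empty there.\<close>

definition horizontal_proximal_subdifferential ::
    "('a::real_inner \<Rightarrow> ereal) \<Rightarrow> 'a \<Rightarrow> 'a set" where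
  "horizontal_proximal_subdifferential f x =
     {v. (v, 0) \<in> proximal_normal_cone (epi f) (x, real_of_ereal (f x))}"

end

theory Submission
  imports Defs
begin

text \<open>
  Fix \<open>t\<close> and a point \<open>y\<close> near \<open>x t\<close>. Solving \<open>z' = \<nabla>\<^sub>p H(z, p)\<close> backwards from \<open>z t = y\<close> gives a
  trajectory with \<open>min_time (z 0) \<le> t + min_time y\<close>, so the proximal inequality at \<open>x 0\<close> may be
  tested on \<open>z 0\<close>. Gronwall gives \<open>|z - x| \<le> C |y - x t|\<close>, and since \<open>- p' \<in> \<partial>\<^sub>x H(x, p)\<close>, semiconvexity
  of \<open>H\<close> in the state bounds the derivative of \<open>- p \<bullet> (z - x)\<close> by \<open>C |z - x|\<^sup>2\<close>; hence the proximal
  inequality is transported from time \<open>0\<close> to time \<open>t\<close>. An arc \<open>p\<close> that vanishes somewhere vanishes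
  identically because \<open>|p'| \<le> L |p|\<close>. Testing the inequality at \<open>x t\<close> on \<open>x\<close> itself, both forwards and
  backwards in time, yields \<open>H(x, p) = p \<bullet> x' = 0\<close> almost everywhere, thus everywhere by continuity.
\<close>

subsection \<open>Absolutely continuous functions\<close>

text \<open>\<open>H(x, p)\<close> is a support function in \<open>p\<close>, so its gradient in
  \<open>p\<close> is the maximising velocity; hence \<open>p \<bullet> z' = H(z, p)\<close> along
  the comparison arc, and the pairing of \<open>p\<close> with \<open>z' - x'\<close> is a
  difference of Hamiltonians. At \<open>p = 0\<close> the maximiser is in general not unique and
  (H2) is silent, so the closed loop is Lipschitz only along a costate without zeros; this forces
  the split on whether \<open>p\<close> vanishes. The constants of (F2), (H1) and (H2) are local in
  the state, hence the truncation to a ball and the restriction to \<open>y\<close> near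
  \<open>x t\<close>; for distant \<open>y\<close> a linear term is dominated by a quadratic one.
  Heights in the epigraph cause no loss: running back for time \<open>t\<close> shifts the tested
  height and the value on \<open>x\<close> by the same amount, and the last component of a
  horizontal normal is zero. Derivatives exist only almost everywhere, so differential inequalities
  are integrated by a mean value inequality with a null exceptional set, proved by a gauge argument.
  Arcs are upgraded to Lipschitz ones, a class closed under products on a compact interval, which
  makes the scalar quantities absolutely continuous.\<close>

lemma tagged_partial_division_Icc:
  fixes a b :: real
  assumes "p tagged_partial_division_of {a..b}" "(x, K) \<in> p"
  obtains u v where "K = {u..v}" "u \<le> v" "Inf K = u" "Sup K = v" "a \<le> u" "v \<le> b" "u \<le> x" "x \<le> v"
proof -
  obtain u v where uv: "K = {u..v}" "x \<in> K" "K \<subseteq> {a..b}"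
    using assms unfolding tagged_partial_division_of_def by (metis box_real(2))
  then have "u \<le> v" by auto
  with uv show thesis by (intro that[of u v]) auto
qed

text \<open>Absolute continuity speaks of finite sets of endpoint pairs, a gauge delivers tagged
  intervals; this is the bridge. The open pieces are disjoint subsets of \<open>U\<close>, so their
  lengths add up to at most its measure.\<close>

lemma AC_sum_bound:
  fixes f :: "real \<Rightarrow> 'a::real_normed_vector"
  assumes ac: "\<forall>P :: (real \<times> real) set. finite P \<longrightarrow>
        (\<forall>(u, v)\<in>P. a \<le> u \<and> u \<le> v \<and> v \<le> b) \<longrightarrow>
        disjoint_family_on (\<lambda>(u, v). {u<..<v}) P \<longrightarrow>
        (\<Sum>(u, v)\<in>P. v - u) < \<delta> \<longrightarrow> (\<Sum>(u, v)\<in>P. norm (f v - f u)) < \<epsilon>"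
    and p: "p tagged_partial_division_of {a..b}"
    and U: "(\<Union>(x, K)\<in>p. K) \<subseteq> U"
    and meas: "U \<in> lmeasurable" "measure lebesgue U < \<delta>"
  shows "(\<Sum>(x, K)\<in>p. Sup K - Inf K) \<le> measure lebesgue U"
    and "(\<Sum>(x, K)\<in>p. norm (f (Sup K) - f (Inf K))) < \<epsilon>"
proof -
  define h :: "real \<times> real set \<Rightarrow> real \<times> real" where "h = (\<lambda>(x, K). (Inf K, Sup K))"
  have fin: "finite p" using p by (auto simp: tagged_partial_division_of_def)
  have K: "\<exists>u v. K = {u..v} \<and> u \<le> v \<and> Inf K = u \<and> Sup K = v \<and> a \<le> u \<and> v \<le> b"
    if "(x, K) \<in> p" for x K
    using tagged_partial_division_Icc[OF p that] by metis
  have disj: "{Inf K<..<Sup K} \<inter> {Inf K'<..<Sup K'} = {}"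
    if xK: "(x, K) \<in> p" "(x', K') \<in> p" "(x, K) \<noteq> (x', K')" for x K x' K'
  proof -
    have "interior K \<inter> interior K' = {}"
      using p xK unfolding tagged_partial_division_of_def by blast
    then show ?thesis using K[OF xK(1)] K[OF xK(2)] by fastforce
  qed
  \<comment> \<open>Different pieces with equal endpoints have disjoint interiors only if they are
    degenerate, and the summands vanish there; so the reindexing does not have to establish
    injectivity of \<open>h\<close>.\<close>
  have same: "Inf K = Sup K" if "(x, K) \<in> p" "(x', K') \<in> p" "(x, K) \<noteq> (x', K')"
      "Inf K = Inf K'" "Sup K = Sup K'" for x K x' K'
    using disj[OF that(1-3)] that(4,5) K[OF that(1)] by (metis Int_absorb greaterThanLessThan_empty_iff order_antisym)
  let ?P = "h ` p"
  have dP: "disjoint_family_on (\<lambda>(u, v). {u<..<v}) ?P"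
    unfolding disjoint_family_on_def
  proof (intro ballI impI)
    fix m n assume "m \<in> ?P" "n \<in> ?P" and mn: "m \<noteq> n"
    then obtain x K x' K' where xK: "(x, K) \<in> p" "(x', K') \<in> p"
      and eq: "m = (Inf K, Sup K)" "n = (Inf K', Sup K')"
      unfolding h_def by auto
    with mn have "(x, K) \<noteq> (x', K')" by auto
    from disj[OF xK this] eq
    show "(case m of (u, v) \<Rightarrow> {u<..<v}) \<inter> (case n of (u, v) \<Rightarrow> {u<..<v}) = {}" by simp
  qed
  have reidx: "(\<Sum>(u, v)\<in>?P. G u v) = (\<Sum>(x, K)\<in>p. G (Inf K) (Sup K))"
    if "\<And>u. G u u = 0" for G :: "real \<Rightarrow> real \<Rightarrow> real"
  proof -
    have "(\<Sum>(u, v)\<in>?P. G u v) = sum ((\<lambda>(u, v). G u v) \<circ> h) p"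
    proof (rule sum.reindex_nontrivial[OF fin])
      fix m n assume "m \<in> p" "n \<in> p" "m \<noteq> n" "h m = h n"
      then show "(case h m of (u, v) \<Rightarrow> G u v) = 0"
        using same that unfolding h_def
        by (cases m; cases n; simp) (metis that)
    qed
    also have "\<dots> = (\<Sum>(x, K)\<in>p. G (Inf K) (Sup K))"
      by (intro sum.cong) (auto simp: h_def)
    finally show ?thesis .
  qed
  have "measure lebesgue (\<Union>m\<in>?P. (\<lambda>(u, v). {u<..<v}) m) =
      (\<Sum>m\<in>?P. measure lebesgue ((\<lambda>(u, v). {u<..<v}) m))"
  proof (rule measure_finite_Union[OF _ _ dP])
    show "emeasure lebesgue (case m of (u, v) \<Rightarrow> {u<..<v}) \<noteq> \<infinity>" for m :: "real \<times> real"
      by (cases m) (use lmeasurable_interval(2) fmeasurableD2 box_real in fastforce)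
  qed (use fin in \<open>auto simp: h_def\<close>)
  also have "\<dots> = (\<Sum>(u, v)\<in>?P. v - u)"
    by (intro sum.cong) (use K in \<open>fastforce simp: h_def\<close>)+
  finally have eq: "(\<Sum>(u, v)\<in>?P. v - u) = measure lebesgue (\<Union>m\<in>?P. (\<lambda>(u, v). {u<..<v}) m)" by simp
  also have "\<dots> \<le> measure lebesgue U"
  proof (rule measure_mono_fmeasurable[OF _ _ meas(1)])
    show "(\<Union>m\<in>?P. (\<lambda>(u, v). {u<..<v}) m) \<subseteq> U"
      using U K by (fastforce simp: h_def)
    show "(\<Union>m\<in>?P. (\<lambda>(u, v). {u<..<v}) m) \<in> sets lebesgue"
      using fin by (auto simp: h_def intro!: sets.finite_UN)
  qed
  finally have le: "(\<Sum>(u, v)\<in>?P. v - u) \<le> measure lebesgue U" .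
  then show "(\<Sum>(x, K)\<in>p. Sup K - Inf K) \<le> measure lebesgue U"
    using reidx[of "\<lambda>u v. v - u"] by simp
  have "(\<Sum>(u, v)\<in>?P. norm (f v - f u)) < \<epsilon>"
  proof (rule ac[rule_format, OF _ _ dP])
    show "finite ?P" using fin by simp
    show "case m of (u, v) \<Rightarrow> a \<le> u \<and> u \<le> v \<and> v \<le> b" if "m \<in> ?P" for m
      using that K by (fastforce simp: h_def)
    show "(\<Sum>(u, v)\<in>?P. v - u) < \<delta>" using le meas(2) by simp
  qed
  then show "(\<Sum>(x, K)\<in>p. norm (f (Sup K) - f (Inf K))) < \<epsilon>"
    using reidx[of "\<lambda>u v. norm (f v - f u)"] by simp
qed

text \<open>Take a gauge that forces intervals tagged in \<open>N\<close> into an open \<open>U \<supseteq> N\<close> of small measure, where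
  absolute continuity controls the increments, and elsewhere follows the derivative.\<close>

lemma AC_increment_le:
  fixes f :: "real \<Rightarrow> real"
  assumes ac: "absolutely_continuous_on_interval a b f" and ab: "a \<le> b"
    and N: "negligible N"
    and der: "\<And>s. s \<in> {a..b} - N \<Longrightarrow>
        \<exists>d\<le>C. (f has_vector_derivative d) (at s within {a..b})"
  shows "f b - f a \<le> C * (b - a)"
proof (rule field_le_epsilon)
  fix e :: real assume e: "e > 0"
  define e1 where "e1 = e / (3 * (b - a + 1))"
  have e1: "e1 > 0" "e1 * (b - a) \<le> e / 3"
    using e ab by (auto simp: e1_def divide_simps)
  have "e / 3 > 0" using e by simp
  with ac obtain \<delta> where \<delta>: "\<delta> > 0" and acd: "\<forall>P :: (real \<times> real) set.
        finite P \<longrightarrow> (\<forall>(u, v)\<in>P. a \<le> u \<and> u \<le> v \<and> v \<le> b) \<longrightarrow>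
        disjoint_family_on (\<lambda>(u, v). {u<..<v}) P \<longrightarrow>
        (\<Sum>(u, v)\<in>P. v - u) < \<delta> \<longrightarrow>
        (\<Sum>(u, v)\<in>P. norm (f v - f u)) < e / 3"
    unfolding absolutely_continuous_on_interval_def by meson
  \<comment> \<open>The error \<open>e\<close> is spent in thirds: \<open>e1\<close> for the
    linearisation away from \<open>N\<close>, \<open>\<delta>\<close> for the increments over pieces
    tagged in \<open>N\<close>, and the second entry of the minimum for \<open>C\<close> times the
    length of those pieces.\<close>
  define \<delta>' where "\<delta>' = min \<delta> (e / (3 * (\<bar>C\<bar> + 1)))"
  have \<delta>': "\<delta>' > 0" "\<delta>' \<le> \<delta>" using \<delta> e by (auto simp: \<delta>'_def)
  have "\<bar>C\<bar> * \<delta>' \<le> \<bar>C\<bar> * (e / (3 * (\<bar>C\<bar> + 1)))"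
    by (intro mult_left_mono) (auto simp: \<delta>'_def)
  also have "\<dots> \<le> e / 3" using e by (simp add: divide_simps algebra_simps)
  finally have C\<delta>: "\<bar>C\<bar> * \<delta>' \<le> e / 3" .
  have Ns: "N \<in> sets lebesgue" "measure lebesgue N = 0" "N \<in> lmeasurable"
    using N by (auto simp: negligible_iff_measure)
  obtain U where U: "open U" "N \<subseteq> U" "U - N \<in> lmeasurable" "emeasure lebesgue (U - N) < ennreal \<delta>'"
    using sets_lebesgue_outer_open[OF Ns(1) \<delta>'(1)] by blast
  have UN: "(U - N) \<union> N = U" using U(2) by auto
  have Um: "U \<in> lmeasurable" using fmeasurable.Un[OF U(3) Ns(3)] unfolding UN .
  have "measure lebesgue U \<le> measure lebesgue (U - N) + measure lebesgue N"
    using measure_Un_le[OF fmeasurableD[OF U(3)] Ns(1)] unfolding UN .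
  moreover have "measure lebesgue (U - N) < \<delta>'"
    using U(4) \<delta>'(1) emeasure_eq_measure2[OF U(3)] by (simp add: ennreal_less_iff)
  ultimately have Ul: "measure lebesgue U < \<delta>'" using Ns(2) by simp
  have "\<exists>r>0. \<forall>y\<in>{a..b}. \<bar>y - s\<bar> < r \<longrightarrow> (\<exists>d\<le>C. \<bar>f y - f s - d * (y - s)\<bar> \<le> e1 * \<bar>y - s\<bar>)"
    if s: "s \<in> {a..b} - N" for s
  proof -
    obtain d where d: "d \<le> C" "(f has_vector_derivative d) (at s within {a..b})"
      using der[OF s] by blast
    then obtain r where "r > 0" "\<forall>y\<in>{a..b}. norm (y - s) < r \<longrightarrow>
        norm (f y - f s - (y - s) *\<^sub>R d) \<le> e1 * norm (y - s)"
      unfolding has_vector_derivative_def has_derivative_within_alt using e1(1) by blast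
    then show ?thesis using d(1)
      by (intro exI[of _ r]) (auto simp: mult.commute)
  qed
  then obtain r where r: "\<And>s. s \<in> {a..b} - N \<Longrightarrow> r s > 0"
    and rd: "\<And>s y. s \<in> {a..b} - N \<Longrightarrow> y \<in> {a..b} \<Longrightarrow> \<bar>y - s\<bar> < r s \<Longrightarrow>
        \<exists>d\<le>C. \<bar>f y - f s - d * (y - s)\<bar> \<le> e1 * \<bar>y - s\<bar>"
    by metis
  define g where "g = (\<lambda>s. if s \<in> N then U else if s \<in> {a..b} then ball s (r s) else ball s 1)"
  have "gauge g" unfolding gauge_def g_def using U r by auto
  then obtain p where p: "p tagged_division_of {a..b}" "g fine p"
    using fine_division_exists_real by blast
  have fin: "finite p" using p(1) by auto
  have ptp: "p tagged_partial_division_of {a..b}" using p(1) by (simp add: tagged_division_of_def)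
  define q where "q = {(x, K) \<in> p. x \<in> N}"
  have qp: "q \<subseteq> p" by (auto simp: q_def)
  have qt: "q tagged_partial_division_of {a..b}"
    using ptp qp by (rule tagged_partial_division_subset)
  have qU: "(\<Union>(x, K)\<in>q. K) \<subseteq> U"
    using p(2) unfolding q_def fine_def g_def by fastforce
  have "measure lebesgue U < \<delta>" using Ul \<delta>'(2) by simp
  note bnd = AC_sum_bound[OF acd qt qU Um this]
  have b1: "(\<Sum>(x, K)\<in>q. Sup K - Inf K) \<le> \<delta>'"
    using bnd(1) Ul by linarith
  have b2: "(\<Sum>(x, K)\<in>q. \<bar>f (Sup K) - f (Inf K)\<bar>) < e / 3"
    using bnd(2) by simp
  have K: "Inf K \<le> Sup K" if "(x, K) \<in> p" for x K
    using tagged_partial_division_Icc[OF ptp that] by metis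
  let ?D = "\<lambda>(x :: real, K). f (Sup K) - f (Inf K) - C * (Sup K - Inf K)"
  let ?l = "\<lambda>(x :: real, K). Sup K - Inf K :: real"
  have tot: "sum ?D p = f b - f a - C * (b - a)"
  proof -
    have "sum ?D p = (\<Sum>(x, K)\<in>p. (f (Sup K) - C * Sup K) - (f (Inf K) - C * Inf K))"
      by (intro sum.cong) (auto simp: algebra_simps)
    also have "\<dots> = (f b - C * b) - (f a - C * a)"
      by (rule additive_tagged_division_1[OF ab p(1)])
    finally show ?thesis by (simp add: algebra_simps)
  qed
  have len: "sum ?l p = b - a"
    using additive_tagged_division_1[OF ab p(1), of "\<lambda>x. x"] by simp
  have "sum ?D q \<le> (\<Sum>(x, K)\<in>q. \<bar>f (Sup K) - f (Inf K)\<bar> + \<bar>C\<bar> * (Sup K - Inf K))"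
  proof (rule sum_mono, clarify)
    fix x :: real and L :: "real set" assume "(x, L) \<in> q"
    with qp K have "Inf L \<le> Sup L" by blast
    then have "- C * (Sup L - Inf L) \<le> \<bar>C\<bar> * (Sup L - Inf L)"
      by (intro mult_right_mono) auto
    then show "f (Sup L) - f (Inf L) - C * (Sup L - Inf L) \<le> \<bar>f (Sup L) - f (Inf L)\<bar> + \<bar>C\<bar> * (Sup L - Inf L)"
      by linarith
  qed
  also have "\<dots> = (\<Sum>(x, K)\<in>q. \<bar>f (Sup K) - f (Inf K)\<bar>) + \<bar>C\<bar> * sum ?l q"
    by (simp add: sum.distrib case_prod_beta sum_distrib_left)
  also have "\<dots> \<le> e / 3 + \<bar>C\<bar> * \<delta>'"
    using b1 b2 by (intro add_mono mult_left_mono) auto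
  finally have s1: "sum ?D q \<le> e / 3 + e / 3" using C\<delta> by linarith
  have "sum ?D (p - q) \<le> (\<Sum>m\<in>p - q. e1 * ?l m)"
  proof (rule sum_mono, clarify)
    fix x :: real and L :: "real set" assume xL: "(x, L) \<in> p" "(x, L) \<notin> q"
    obtain u v where uv: "L = {u..v}" "u \<le> v" "Inf L = u" "Sup L = v" "a \<le> u" "v \<le> b" "u \<le> x" "x \<le> v"
      using tagged_partial_division_Icc[OF ptp xL(1)] .
    have xN: "x \<in> {a..b} - N" using xL uv by (auto simp: q_def)
    then have "g x = ball x (r x)" by (auto simp: g_def)
    with p(2) xL(1) have sub: "{u..v} \<subseteq> ball x (r x)" unfolding fine_def uv(1) by fastforce
    have "u \<in> ball x (r x)" "v \<in> ball x (r x)" using subsetD[OF sub, of u] subsetD[OF sub, of v] uv(2) by auto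
    then have "\<bar>u - x\<bar> < r x" "\<bar>v - x\<bar> < r x" by (auto simp: dist_real_def)
    moreover have "u \<in> {a..b}" "v \<in> {a..b}" using uv by auto
    \<comment> \<open>The tag splits the piece into \<open>[u, x]\<close> and \<open>[x, v]\<close>.
      Each half gets its own slope; only the common bound \<open>C\<close> on the slopes enters, so
      they need not be identified.\<close>
    ultimately obtain d d' where d: "d \<le> C" "\<bar>f u - f x - d * (u - x)\<bar> \<le> e1 * \<bar>u - x\<bar>"
      and d': "d' \<le> C" "\<bar>f v - f x - d' * (v - x)\<bar> \<le> e1 * \<bar>v - x\<bar>"
      using rd[OF xN] by meson
    have "d * (x - u) \<le> C * (x - u)" "d' * (v - x) \<le> C * (v - x)"
      using d(1) d'(1) uv by (auto intro: mult_right_mono)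
    moreover have "\<bar>u - x\<bar> = x - u" "\<bar>v - x\<bar> = v - x" using uv by auto
    moreover have "d * (u - x) = - (d * (x - u))" by (simp add: algebra_simps)
    moreover have "e1 * (x - u) + e1 * (v - x) = e1 * (v - u)"
      "C * (x - u) + C * (v - x) = C * (v - u)" by (auto simp: algebra_simps)
    ultimately have "f v - f u \<le> C * (v - u) + e1 * (v - u)" using d(2) d'(2) by (smt (verit))
    then show "f (Sup L) - f (Inf L) - C * (Sup L - Inf L) \<le> e1 * (Sup L - Inf L)"
      using uv by simp
  qed
  also have "\<dots> \<le> (\<Sum>m\<in>p. e1 * ?l m)"
    by (rule sum_mono2[OF fin]) (use e1 K in \<open>fastforce\<close>)+
  also have "\<dots> = e1 * (b - a)" unfolding len[symmetric] by (simp add: sum_distrib_left)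
  finally have s2: "sum ?D (p - q) \<le> e / 3" using e1(2) by linarith
  have "sum ?D p = sum ?D (p - q) + sum ?D q"
    using sum.subset_diff[OF qp fin] by blast
  then show "f b - f a \<le> C * (b - a) + e" using tot s1 s2 by linarith
qed

lemma lipschitz_imp_AC:
  assumes "L-lipschitz_on {a..b} f"
  shows "absolutely_continuous_on_interval a b f"
  unfolding absolutely_continuous_on_interval_def
proof (intro allI impI)
  fix \<epsilon> :: real assume e: "\<epsilon> > 0"
  have L: "L \<ge> 0" using assms by (rule lipschitz_on_nonneg)
  show "\<exists>\<delta>>0. \<forall>P :: (real \<times> real) set. finite P \<longrightarrow>
      (\<forall>(u, v)\<in>P. a \<le> u \<and> u \<le> v \<and> v \<le> b) \<longrightarrow>
      disjoint_family_on (\<lambda>(u, v). {u<..<v}) P \<longrightarrow>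
      (\<Sum>(u, v)\<in>P. v - u) < \<delta> \<longrightarrow> (\<Sum>(u, v)\<in>P. norm (f v - f u)) < \<epsilon>"
  proof (intro exI[of _ "\<epsilon> / (L + 1)"] conjI allI impI)
    fix P :: "(real \<times> real) set"
    assume P: "\<forall>(u, v)\<in>P. a \<le> u \<and> u \<le> v \<and> v \<le> b" and s: "(\<Sum>(u, v)\<in>P. v - u) < \<epsilon> / (L + 1)"
    have "(\<Sum>(u, v)\<in>P. norm (f v - f u)) \<le> (\<Sum>(u, v)\<in>P. (L + 1) * (v - u))"
    proof (rule sum_mono, clarify)
      fix u v assume "(u, v) \<in> P"
      then have uv: "u \<in> {a..b}" "v \<in> {a..b}" "u \<le> v" using P by auto
      then have "norm (f v - f u) \<le> L * norm (v - u)"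
        using lipschitz_on_normD[OF assms] by blast
      also have "\<dots> \<le> (L + 1) * (v - u)" using uv by (simp add: mult_right_mono)
      finally show "norm (f v - f u) \<le> (L + 1) * (v - u)" .
    qed
    also have "\<dots> = (L + 1) * (\<Sum>(u, v)\<in>P. v - u)" by (simp add: sum_distrib_left case_prod_beta)
    also have "\<dots> < \<epsilon>" using s L by (simp add: pos_less_divide_eq mult.commute)
    finally show "(\<Sum>(u, v)\<in>P. norm (f v - f u)) < \<epsilon>" .
  qed (use e L in simp)
qed

lemma AC_subinterval:
  assumes "absolutely_continuous_on_interval a b f" "a \<le> s" "t \<le> b"
  shows "absolutely_continuous_on_interval s t f"
  unfolding absolutely_continuous_on_interval_def
proof (intro allI impI)
  fix \<epsilon> :: real assume "\<epsilon> > 0"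
  with assms(1) obtain \<delta> where "\<delta> > 0" and d: "\<forall>P :: (real \<times> real) set. finite P \<longrightarrow>
      (\<forall>(u, v)\<in>P. a \<le> u \<and> u \<le> v \<and> v \<le> b) \<longrightarrow>
      disjoint_family_on (\<lambda>(u, v). {u<..<v}) P \<longrightarrow>
      (\<Sum>(u, v)\<in>P. v - u) < \<delta> \<longrightarrow> (\<Sum>(u, v)\<in>P. norm (f v - f u)) < \<epsilon>"
    unfolding absolutely_continuous_on_interval_def by meson
  show "\<exists>\<delta>>0. \<forall>P :: (real \<times> real) set. finite P \<longrightarrow>
      (\<forall>(u, v)\<in>P. s \<le> u \<and> u \<le> v \<and> v \<le> t) \<longrightarrow>
      disjoint_family_on (\<lambda>(u, v). {u<..<v}) P \<longrightarrow>
      (\<Sum>(u, v)\<in>P. v - u) < \<delta> \<longrightarrow> (\<Sum>(u, v)\<in>P. norm (f v - f u)) < \<epsilon>"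
  proof (intro exI[of _ \<delta>] conjI allI impI)
    fix P :: "(real \<times> real) set"
    assume "finite P" and P: "\<forall>(u, v)\<in>P. s \<le> u \<and> u \<le> v \<and> v \<le> t"
      and "disjoint_family_on (\<lambda>(u, v). {u<..<v}) P" "(\<Sum>(u, v)\<in>P. v - u) < \<delta>"
    moreover have "\<forall>(u, v)\<in>P. a \<le> u \<and> u \<le> v \<and> v \<le> b" using P assms(2,3) by fastforce
    ultimately show "(\<Sum>(u, v)\<in>P. norm (f v - f u)) < \<epsilon>" using d by blast
  qed (rule \<open>\<delta> > 0\<close>)
qed

text \<open>The endpoints \<open>s\<close> and \<open>t\<close> join the null set, so two-sided
  derivatives at interior points suffice; all later arcs are supplied in that form.\<close>

lemma AC_increment_le_within:
  fixes f :: "real \<Rightarrow> real"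
  assumes ac: "absolutely_continuous_on_interval a b f" and N: "negligible N"
    and der: "\<And>r. r \<in> {a<..<b} - N \<Longrightarrow> \<exists>d\<le>C. (f has_vector_derivative d) (at r)"
    and st: "a \<le> s" "s \<le> t" "t \<le> b"
  shows "f t - f s \<le> C * (t - s)"
proof (rule AC_increment_le[where N = "insert s (insert t N)"])
  show "absolutely_continuous_on_interval s t f" using AC_subinterval[OF ac st(1,3)] .
  fix r assume "r \<in> {s..t} - insert s (insert t N)"
  with st have "r \<in> {a<..<b} - N" by auto
  with der show "\<exists>d\<le>C. (f has_vector_derivative d) (at r within {s..t})"
    by (meson has_vector_derivative_at_within)
qed (use st N in auto)

lemma AC_bounded_derivative_imp_lipschitz:
  fixes f :: "real \<Rightarrow> 'a::real_inner"
  assumes ac: "absolutely_continuous_on_interval a b f" and N: "negligible N"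
    and der: "\<And>r. r \<in> {a<..<b} - N \<Longrightarrow> \<exists>d. (f has_vector_derivative d) (at r) \<and> norm d \<le> C"
    and C: "0 \<le> C"
  shows "C-lipschitz_on {a..b} f"
proof (rule lipschitz_on_leI[OF _ C])
  fix s t assume st: "s \<in> {a..b}" "t \<in> {a..b}" "s \<le> t"
  \<comment> \<open>In this direction the scalar increment equals the norm of the vector increment,
    which reduces the claim to the real-valued mean value inequality.\<close>
  define e where "e = sgn (f t - f s)"
  have e: "norm e \<le> 1" by (simp add: e_def norm_sgn)
  have "absolutely_continuous_on_interval a b (\<lambda>r. f r \<bullet> e)"
    unfolding absolutely_continuous_on_interval_def
  proof (intro allI impI)
    fix \<epsilon> :: real assume "\<epsilon> > 0"
    with ac obtain \<delta> where "\<delta> > 0" and d: "\<forall>P :: (real \<times> real) set. finite P \<longrightarrow>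
        (\<forall>(u, v)\<in>P. a \<le> u \<and> u \<le> v \<and> v \<le> b) \<longrightarrow>
        disjoint_family_on (\<lambda>(u, v). {u<..<v}) P \<longrightarrow>
        (\<Sum>(u, v)\<in>P. v - u) < \<delta> \<longrightarrow> (\<Sum>(u, v)\<in>P. norm (f v - f u)) < \<epsilon>"
      unfolding absolutely_continuous_on_interval_def by meson
    have le: "(\<Sum>(u, v)\<in>P. norm (f v \<bullet> e - f u \<bullet> e)) \<le> (\<Sum>(u, v)\<in>P. norm (f v - f u))" for P
    proof (rule sum_mono, clarify)
      fix u v
      have "norm (f v \<bullet> e - f u \<bullet> e) \<le> norm (f v - f u) * norm e"
        unfolding inner_diff_left[symmetric] real_norm_def by (rule Cauchy_Schwarz_ineq2)
      also have "\<dots> \<le> norm (f v - f u)" using e by (simp add: mult_left_le)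
      finally show "norm (f v \<bullet> e - f u \<bullet> e) \<le> norm (f v - f u)" .
    qed
    show "\<exists>\<delta>>0. \<forall>P :: (real \<times> real) set. finite P \<longrightarrow>
        (\<forall>(u, v)\<in>P. a \<le> u \<and> u \<le> v \<and> v \<le> b) \<longrightarrow>
        disjoint_family_on (\<lambda>(u, v). {u<..<v}) P \<longrightarrow>
        (\<Sum>(u, v)\<in>P. v - u) < \<delta> \<longrightarrow> (\<Sum>(u, v)\<in>P. norm (f v \<bullet> e - f u \<bullet> e)) < \<epsilon>"
      using d \<open>\<delta> > 0\<close> le by (meson le_less_trans)
  qed
  moreover have "\<exists>d\<le>C. ((\<lambda>r. f r \<bullet> e) has_vector_derivative d) (at r)" if r: "r \<in> {a<..<b} - N" for r
  proof -
    obtain d where d: "(f has_vector_derivative d) (at r)" "norm d \<le> C" using der[OF r] by blast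
    have "d \<bullet> e \<le> norm d * norm e" by (rule norm_cauchy_schwarz)
    also have "\<dots> \<le> norm d" using e by (simp add: mult_left_le)
    finally have "d \<bullet> e \<le> C" using d(2) by simp
    moreover have "((\<lambda>r. f r \<bullet> e) has_vector_derivative d \<bullet> e) (at r)"
      using bounded_linear.has_vector_derivative[OF bounded_linear_inner_left d(1)] .
    ultimately show ?thesis by blast
  qed
  ultimately have "f t \<bullet> e - f s \<bullet> e \<le> C * (t - s)"
    by (rule AC_increment_le_within[OF _ N]) (use st in auto)
  moreover have "f t \<bullet> e - f s \<bullet> e = norm (f t - f s)"
    unfolding inner_diff_left[symmetric] e_def sgn_div_norm
    by (cases "f t = f s") (simp_all add: dot_square_norm power2_eq_square)
  ultimately show "dist (f s) (f t) \<le> C * dist s t"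
    using st by (simp add: dist_norm norm_minus_commute dist_real_def)
qed

section \<open>Products of Lipschitz arcs and Gronwall's inequality\<close>

lemma lipschitz_on_inner_Icc:
  fixes f g :: "real \<Rightarrow> 'a::real_inner"
  assumes f: "L-lipschitz_on {a..b} f" and g: "M-lipschitz_on {a..b} g"
  obtains C where "C-lipschitz_on {a..b} (\<lambda>s. f s \<bullet> g s)"
proof -
  have "bounded (f ` {a..b})" "bounded (g ` {a..b})"
    using f g by (auto intro!: compact_imp_bounded compact_continuous_image lipschitz_on_continuous_on)
  then obtain A B where "\<And>s. s \<in> {a..b} \<Longrightarrow> norm (f s) \<le> A" "\<And>s. s \<in> {a..b} \<Longrightarrow> norm (g s) \<le> B"
    by (metis bounded_iff imageI)
  then have A: "\<And>s. s \<in> {a..b} \<Longrightarrow> norm (f s) \<le> \<bar>A\<bar>" and B: "\<And>s. s \<in> {a..b} \<Longrightarrow> norm (g s) \<le> \<bar>B\<bar>"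
    by force+
  have LM: "L \<ge> 0" "M \<ge> 0" using f g by (auto dest: lipschitz_on_nonneg)
  have "(L * \<bar>B\<bar> + \<bar>A\<bar> * M)-lipschitz_on {a..b} (\<lambda>s. f s \<bullet> g s)"
  proof (rule lipschitz_onI)
    fix s t assume st: "s \<in> {a..b}" "t \<in> {a..b}"
    have "f s \<bullet> g s - f t \<bullet> g t = (f s - f t) \<bullet> g s + f t \<bullet> (g s - g t)"
      by (simp add: inner_diff_left inner_diff_right)
    also have "\<bar>\<dots>\<bar> \<le> norm (f s - f t) * norm (g s) + norm (f t) * norm (g s - g t)"
      by (rule order_trans[OF abs_triangle_ineq add_mono[OF Cauchy_Schwarz_ineq2 Cauchy_Schwarz_ineq2]])
    also have "\<dots> \<le> (L * norm (s - t)) * \<bar>B\<bar> + \<bar>A\<bar> * (M * norm (s - t))"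
      using lipschitz_on_normD[OF f st] lipschitz_on_normD[OF g st] A[OF st(2)] B[OF st(1)] LM
      by (intro add_mono mult_mono) auto
    finally show "dist (f s \<bullet> g s) (f t \<bullet> g t) \<le> (L * \<bar>B\<bar> + \<bar>A\<bar> * M) * dist s t"
      by (simp add: dist_norm algebra_simps)
  qed (use LM in auto)
  then show thesis by (rule that)
qed

lemma lipschitz_on_exp_Icc:
  obtains C where "C-lipschitz_on {a..b} (\<lambda>s :: real. exp (c * s))"
proof -
  define C where "C = \<bar>c\<bar> * exp (\<bar>c\<bar> * (\<bar>a\<bar> + \<bar>b\<bar>))"
  have "C-lipschitz_on {a..b} (\<lambda>s :: real. exp (c * s))"
  proof (rule bounded_derivative_imp_lipschitz)
    fix s assume s: "s \<in> {a..b}"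
    show "((\<lambda>s. exp (c * s)) has_derivative (*) (c * exp (c * s))) (at s within {a..b})"
      by (auto intro!: derivative_eq_intros)
    have "c * s \<le> \<bar>c\<bar> * \<bar>s\<bar>" using abs_ge_self[of "c * s"] by (simp add: abs_mult)
    also have "\<dots> \<le> \<bar>c\<bar> * (\<bar>a\<bar> + \<bar>b\<bar>)" using s by (intro mult_left_mono) auto
    finally have "c * s \<le> \<bar>c\<bar> * (\<bar>a\<bar> + \<bar>b\<bar>)" .
    then have "\<bar>c\<bar> * exp (c * s) \<le> C" unfolding C_def by (intro mult_left_mono) auto
    then have "norm (c * exp (c * s) * y) \<le> C * norm y" for y
      by (simp add: abs_mult mult_right_mono)
    then show "onorm ((*) (c * exp (c * s))) \<le> C"
      by (rule onorm_bound[rotated]) (simp add: C_def)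
  qed (auto simp: C_def)
  then show thesis by (rule that)
qed

text \<open>The square of the norm is differentiable even where \<open>q\<close> vanishes. The bound
  runs in both directions of time: backwards it controls the comparison arc from its endpoint, and
  for the costate it excludes isolated zeros.\<close>

lemma gronwall_two_sided:
  fixes q :: "real \<Rightarrow> 'a::real_inner"
  assumes q: "M-lipschitz_on {a..b} q" and N: "negligible N" and L: "L \<ge> 0"
    and der: "\<And>r. r \<in> {a<..<b} - N \<Longrightarrow>
      \<exists>d. (q has_vector_derivative d) (at r) \<and> norm d \<le> L * norm (q r)"
    and st: "s \<in> {a..b}" "t \<in> {a..b}"
  shows "(norm (q s))\<^sup>2 \<le> exp (2 * L * (b - a)) * (norm (q t))\<^sup>2"
proof -
  obtain C where qq: "C-lipschitz_on {a..b} (\<lambda>r. q r \<bullet> q r)"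
    using lipschitz_on_inner_Icc[OF q q] .
  \<comment> \<open>For \<open>k = 2 L\<close> the weighted square \<open>exp (k r) |q r|^2\<close>
    increases, for \<open>k = - 2 L\<close> it decreases. The prefactor \<open>- k\<close> merges
    both into one decreasing function: its derivative contains \<open>- k^2 |q|^2\<close>, which
    absorbs the mixed term because \<open>2 |q \<bullet> q'| \<le> |k| |q|^2\<close>.\<close>
  have key: "- (k * (exp (k * t) * (q t \<bullet> q t))) \<le> - (k * (exp (k * s) * (q s \<bullet> q s)))"
    if k: "\<bar>k\<bar> = 2 * L" and st: "s \<in> {a..b}" "t \<in> {a..b}" "s \<le> t" for k s t
  proof -
    obtain D where ex: "D-lipschitz_on {a..b} (\<lambda>r. exp (k * r))"
      using lipschitz_on_exp_Icc .
    obtain E where "E-lipschitz_on {a..b} (\<lambda>r. exp (k * r) \<bullet> (q r \<bullet> q r))"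
      using lipschitz_on_inner_Icc[OF ex qq] .
    then have "(\<bar>-k\<bar> * E)-lipschitz_on {a..b} (\<lambda>r. (- k) * (exp (k * r) * (q r \<bullet> q r)))"
      unfolding inner_real_def by (rule lipschitz_on_cmult_real)
    then have "absolutely_continuous_on_interval a b (\<lambda>r. - (k * (exp (k * r) * (q r \<bullet> q r))))"
      by (simp add: lipschitz_imp_AC)
    moreover have "\<exists>d\<le>0. ((\<lambda>r. - (k * (exp (k * r) * (q r \<bullet> q r)))) has_vector_derivative d) (at r)"
      if r: "r \<in> {a<..<b} - N" for r
    proof -
      obtain d where d: "(q has_vector_derivative d) (at r)" "norm d \<le> L * norm (q r)"
        using der[OF r] by blast
      have i: "((\<lambda>r. q r \<bullet> q r) has_vector_derivative q r \<bullet> d + d \<bullet> q r) (at r)"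
        using bounded_bilinear.has_vector_derivative[OF bounded_bilinear_inner d(1) d(1)] .
      have e: "((\<lambda>r. exp (k * r)) has_vector_derivative k * exp (k * r)) (at r)"
        by (auto intro!: derivative_eq_intros simp: has_real_derivative_iff_has_vector_derivative[symmetric])
      have "((\<lambda>r. - (k * (exp (k * r) * (q r \<bullet> q r)))) has_vector_derivative
          - (k * (exp (k * r) * (q r \<bullet> d + d \<bullet> q r) + k * exp (k * r) * (q r \<bullet> q r)))) (at r)"
        using i e unfolding has_real_derivative_iff_has_vector_derivative[symmetric]
        by (auto intro!: derivative_eq_intros)
      moreover have "- (k * (exp (k * r) * (q r \<bullet> d + d \<bullet> q r) + k * exp (k * r) * (q r \<bullet> q r))) \<le> 0"
      proof -
        have "\<bar>q r \<bullet> d\<bar> \<le> norm (q r) * norm d" by (rule Cauchy_Schwarz_ineq2)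
        also have "\<dots> \<le> norm (q r) * (L * norm (q r))" using d(2) by (intro mult_left_mono) auto
        also have "\<dots> = L * (q r \<bullet> q r)" by (simp add: dot_square_norm power2_eq_square)
        finally have "2 * \<bar>q r \<bullet> d\<bar> \<le> \<bar>k\<bar> * (q r \<bullet> q r)" unfolding k by simp
        then have "\<bar>k\<bar> * (2 * \<bar>q r \<bullet> d\<bar>) \<le> \<bar>k\<bar> * (\<bar>k\<bar> * (q r \<bullet> q r))" by (intro mult_left_mono) auto
        moreover have "\<bar>k\<bar> * (\<bar>k\<bar> * (q r \<bullet> q r)) = k * k * (q r \<bullet> q r)"
          unfolding mult.assoc[symmetric] abs_mult_self_eq ..
        moreover have "\<bar>k * (2 * (q r \<bullet> d))\<bar> = \<bar>k\<bar> * (2 * \<bar>q r \<bullet> d\<bar>)"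
          by (simp add: abs_mult)
        ultimately have "\<bar>k * (2 * (q r \<bullet> d))\<bar> \<le> k * k * (q r \<bullet> q r)" by linarith
        then have "0 \<le> k * (2 * (q r \<bullet> d)) + k * k * (q r \<bullet> q r)" by linarith
        then have "0 \<le> exp (k * r) * (k * (2 * (q r \<bullet> d)) + k * k * (q r \<bullet> q r))" by simp
        then show ?thesis by (simp add: inner_commute algebra_simps)
      qed
      ultimately show ?thesis by blast
    qed
    ultimately have "- (k * (exp (k * t) * (q t \<bullet> q t))) - - (k * (exp (k * s) * (q s \<bullet> q s))) \<le> 0 * (t - s)"
      by (rule AC_increment_le_within[OF _ N]) (use st in auto)
    then show ?thesis by simp
  qed
  show ?thesis
  proof (cases "L = 0 \<or> a = b")
    case False
    then have L0: "L > 0" using L by simp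
    have mono: "exp (2 * L * r) \<le> exp (2 * L * (b - a)) * exp (2 * L * r')"
      if "r \<le> r' + (b - a)" for r r' :: real
    proof -
      have "2 * L * r \<le> 2 * L * (b - a) + 2 * L * r'"
        using mult_left_mono[OF that, of "2 * L"] L by (simp add: algebra_simps)
      then show ?thesis by (simp flip: exp_add)
    qed
    show ?thesis
    proof (cases "s \<le> t")
      case True
      from key[of "2 * L" s t] st True L0
      have "exp (2 * L * s) * (q s \<bullet> q s) \<le> exp (2 * L * t) * (q t \<bullet> q t)" by simp
      also have "\<dots> \<le> (exp (2 * L * (b - a)) * exp (2 * L * s)) * (q t \<bullet> q t)"
        using st by (intro mult_right_mono mono) auto
      finally show ?thesis by (simp add: dot_square_norm)
    next
      case False
      from key[of "- (2 * L)" t s] st False L0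
      have "exp (- (2 * L) * s) * (q s \<bullet> q s) \<le> exp (- (2 * L) * t) * (q t \<bullet> q t)" by simp
      also have "\<dots> \<le> (exp (2 * L * (b - a)) * exp (- (2 * L) * s)) * (q t \<bullet> q t)"
        using st mono[of "- t" "- s"] by (intro mult_right_mono) auto
      finally show ?thesis by (simp add: dot_square_norm)
    qed
  next
    case True
    \<comment> \<open>If \<open>L = 0\<close>, the prefactor in \<open>key\<close> is zero and the
      inequality is void; but then the derivative vanishes and \<open>q\<close> is constant.\<close>
    have "norm (q s) = norm (q t)"
    proof (cases "a = b")
      case True with st show ?thesis by auto
    next
      case False
      with True have "L = 0" by simp
      have "0-lipschitz_on {a..b} q"
        by (rule AC_bounded_derivative_imp_lipschitz[OF lipschitz_imp_AC[OF q] N])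
          (use der \<open>L = 0\<close> in auto)
      from lipschitz_onD[OF this st] show ?thesis by simp
    qed
    with True show ?thesis by auto
  qed
qed

subsection \<open>Ordinary differential equations\<close>

text \<open>A Lipschitz constant in the second argument that is uniform in \<open>s\<close>,
  together with separate continuity in the first, stands in for joint continuity. It serves the
  Picard map and the Hamiltonian along an arc.\<close>

lemma continuous_on_along_arc:
  fixes g :: "real \<Rightarrow> 'a::real_normed_vector \<Rightarrow> 'b::real_normed_vector"
  assumes lip: "\<And>s \<xi> \<eta>. s \<in> S \<Longrightarrow> norm (g s \<xi> - g s \<eta>) \<le> L * norm (\<xi> - \<eta>)"
    and cont: "\<And>\<xi>. continuous_on S (\<lambda>s. g s \<xi>)"
    and z: "continuous_on S z"
  shows "continuous_on S (\<lambda>s. g s (z s))"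
  unfolding continuous_on_def
proof
  fix s0 assume s0: "s0 \<in> S"
  have "((\<lambda>s. L * norm (z s - z s0) + norm (g s (z s0) - g s0 (z s0))) \<longlongrightarrow>
      L * norm (z s0 - z s0) + norm (g s0 (z s0) - g s0 (z s0))) (at s0 within S)"
    using z cont[of "z s0"] s0 unfolding continuous_on_def by (intro tendsto_intros) auto
  then have lim: "((\<lambda>s. L * norm (z s - z s0) + norm (g s (z s0) - g s0 (z s0))) \<longlongrightarrow> 0) (at s0 within S)"
    by simp
  have "((\<lambda>s. g s (z s) - g s0 (z s0)) \<longlongrightarrow> 0) (at s0 within S)"
  proof (rule Lim_null_comparison[OF _ lim])
    have "norm (g s (z s) - g s0 (z s0)) \<le> L * norm (z s - z s0) + norm (g s (z s0) - g s0 (z s0))"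
      if "s \<in> S" for s
      using norm_triangle_ineq[of "g s (z s) - g s (z s0)" "g s (z s0) - g s0 (z s0)"] lip[OF that, of "z s" "z s0"]
      by simp
    then show "\<forall>\<^sub>F s in at s0 within S. norm (g s (z s) - g s0 (z s0))
        \<le> L * norm (z s - z s0) + norm (g s (z s0) - g s0 (z s0))"
      by (simp add: eventually_at_filter)
  qed
  then show "((\<lambda>s. g s (z s)) \<longlongrightarrow> g s0 (z s0)) (at s0 within S)"
    by (rule Lim_null[THEN iffD2])
qed

text \<open>Picard-Lindelof on the whole interval: in the weighted unknown \<open>exp (- \<alpha> s) z s\<close>
  with \<open>\<alpha> = 2 L\<close> the Picard map is a contraction with factor \<open>1/2\<close>.\<close>

lemma ode_global_solution:
  fixes g :: "real \<Rightarrow> 'a::euclidean_space \<Rightarrow> 'a"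
  assumes T: "0 \<le> T" and L: "0 < L"
    and lip: "\<And>s \<xi> \<eta>. s \<in> {0..T} \<Longrightarrow> norm (g s \<xi> - g s \<eta>) \<le> L * norm (\<xi> - \<eta>)"
    and cont: "\<And>\<xi>. continuous_on {0..T} (\<lambda>s. g s \<xi>)"
  obtains z where "z 0 = y"
    and "\<And>s. s \<in> {0..T} \<Longrightarrow> (z has_vector_derivative g s (z s)) (at s within {0..T})"
proof -
  define \<alpha> where "\<alpha> = 2 * L"
  \<comment> \<open>Elements of \<open>bcontfun\<close> live on the whole line. Clamping time to
    \<open>{0..T}\<close> makes the Picard image constant outside the interval and hence
    bounded.\<close>
  define c where "c = (\<lambda>s::real. max 0 (min T s))"
  have c: "c s \<in> {0..T}" for s using T by (auto simp: c_def)
  have cid: "c s = s" if "s \<in> {0..T}" for s using that by (auto simp: c_def)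
  have cc: "continuous_on UNIV c" unfolding c_def by (intro continuous_intros)
  define G where "G = (\<lambda>(u :: real \<Rightarrow>\<^sub>C 'a) \<tau>. g \<tau> (exp (\<alpha> * \<tau>) *\<^sub>R u \<tau>))"
  have Gc: "continuous_on {0..T} (G u)" for u
    unfolding G_def
    by (rule continuous_on_along_arc[OF lip cont])
      (auto intro!: continuous_intros)
  define \<Phi> where "\<Phi> = (\<lambda>u s. exp (- \<alpha> * c s) *\<^sub>R (y + integral {0..c s} (G u)))"
  have Gi: "G u integrable_on {0..c s}" for u s
    using c[of s] by (intro integrable_continuous_real continuous_on_subset[OF Gc]) auto
  have \<Phi>c: "\<Phi> u \<in> bcontfun" for u
  proof -
    define h where "h = (\<lambda>s. exp (- \<alpha> * s) *\<^sub>R (y + integral {0..s} (G u)))"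
    have "continuous_on {0..T} (\<lambda>s. integral {0..s} (G u))"
      by (rule indefinite_integral_continuous_1) (rule integrable_continuous_real[OF Gc])
    then have h: "continuous_on {0..T} h" unfolding h_def by (intro continuous_intros)
    have eq: "\<Phi> u = h \<circ> c" by (auto simp: \<Phi>_def h_def)
    have "continuous_on UNIV (h \<circ> c)"
      by (intro continuous_on_compose cc continuous_on_subset[OF h]) (use c in auto)
    moreover have "bounded (range (h \<circ> c))"
    proof (rule bounded_subset)
      show "bounded (h ` {0..T})"
        by (intro compact_imp_bounded compact_continuous_image h) simp
    qed (use c in auto)
    ultimately show ?thesis unfolding eq bcontfun_def by simp
  qed
  have ex: "((\<lambda>\<tau>. exp (\<alpha> * \<tau>)) has_integral (exp (\<alpha> * t) - 1) / \<alpha>) {0..t}" if "0 \<le> t" for t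
  proof -
    have "((\<lambda>\<tau>. exp (\<alpha> * \<tau>)) has_integral exp (\<alpha> * t) / \<alpha> - exp (\<alpha> * 0) / \<alpha>) {0..t}"
      using that L
      by (intro fundamental_theorem_of_calculus)
        (auto intro!: derivative_eq_intros simp: \<alpha>_def has_real_derivative_iff_has_vector_derivative[symmetric])
    then show ?thesis by (simp add: diff_divide_distrib)
  qed
  have contr: "dist (Bcontfun (\<Phi> u)) (Bcontfun (\<Phi> w)) \<le> 1 / 2 * dist u w" for u w
  proof (rule dist_bound)
    fix s
    let ?d = "dist u w" and ?c = "c s"
    have "norm (integral {0..?c} (G u) - integral {0..?c} (G w)) = norm (integral {0..?c} (\<lambda>\<tau>. G u \<tau> - G w \<tau>))"
      using Gi by (simp add: Henstock_Kurzweil_Integration.integral_diff)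
    also have "\<dots> \<le> integral {0..?c} (\<lambda>\<tau>. (L * ?d) * exp (\<alpha> * \<tau>))"
    proof (rule Henstock_Kurzweil_Integration.integral_norm_bound_integral)
      show "(\<lambda>\<tau>. G u \<tau> - G w \<tau>) integrable_on {0..?c}" using Gi by (intro integrable_diff)
      show "(\<lambda>\<tau>. L * ?d * exp (\<alpha> * \<tau>)) integrable_on {0..?c}"
        by (intro integrable_continuous_real continuous_intros)
      fix \<tau> assume \<tau>: "\<tau> \<in> {0..?c}"
      then have "\<tau> \<in> {0..T}" using c[of s] by auto
      then have "norm (G u \<tau> - G w \<tau>) \<le> L * norm (exp (\<alpha> * \<tau>) *\<^sub>R u \<tau> - exp (\<alpha> * \<tau>) *\<^sub>R w \<tau>)"
        unfolding G_def by (rule lip)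
      also have "\<dots> = L * (exp (\<alpha> * \<tau>) * dist (u \<tau>) (w \<tau>))"
        by (simp add: dist_norm flip: scaleR_diff_right)
      also have "\<dots> \<le> L * (exp (\<alpha> * \<tau>) * ?d)"
        using L dist_bounded[of u \<tau> w] by (intro mult_left_mono) auto
      finally show "norm (G u \<tau> - G w \<tau>) \<le> L * ?d * exp (\<alpha> * \<tau>)" by (simp add: mult_ac)
    qed
    also have "\<dots> = (L * ?d) * ((exp (\<alpha> * ?c) - 1) / \<alpha>)"
      using integral_unique[OF ex[of ?c]] c[of s] by simp
    also have "\<dots> = ?d / 2 * (exp (\<alpha> * ?c) - 1)" using L by (simp add: \<alpha>_def)
    also have "\<dots> \<le> ?d / 2 * exp (\<alpha> * ?c)" by (intro mult_left_mono) auto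
    finally have "norm (integral {0..?c} (G u) - integral {0..?c} (G w)) \<le> ?d / 2 * exp (\<alpha> * ?c)" .
    then have "exp (- \<alpha> * ?c) * norm (integral {0..?c} (G u) - integral {0..?c} (G w))
        \<le> exp (- \<alpha> * ?c) * (?d / 2 * exp (\<alpha> * ?c))"
      by (intro mult_left_mono) auto
    also have "\<dots> = ?d / 2" by (simp add: exp_minus)
    finally have "norm (\<Phi> u s - \<Phi> w s) \<le> ?d / 2"
      unfolding \<Phi>_def by (simp flip: scaleR_diff_right)
    then show "dist (apply_bcontfun (Bcontfun (\<Phi> u)) s) (apply_bcontfun (Bcontfun (\<Phi> w)) s) \<le> 1 / 2 * ?d"
      using \<Phi>c by (simp add: Bcontfun_inverse dist_norm)
  qed
  have "\<exists>!u. Bcontfun (\<Phi> u) = u"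
    by (rule banach_fix_type[of "1 / 2"]) (use contr in auto)
  then obtain u where "Bcontfun (\<Phi> u) = u" by blast
  then have u: "apply_bcontfun u s = \<Phi> u s" for s by (metis \<Phi>c Bcontfun_inverse)
  define z where "z = (\<lambda>s. exp (\<alpha> * s) *\<^sub>R u s)"
  have zeq: "z s = y + integral {0..s} (\<lambda>\<tau>. g \<tau> (z \<tau>))" if "s \<in> {0..T}" for s
    unfolding z_def u[of s] unfolding \<Phi>_def cid[OF that] G_def by (simp add: exp_minus)
  have gz: "continuous_on {0..T} (\<lambda>\<tau>. g \<tau> (z \<tau>))"
    using Gc[of u] by (simp add: G_def z_def)
  show thesis
  proof
    show "z 0 = y" using zeq[of 0] T by simp
    fix s assume s: "s \<in> {0..T}"
    have "((\<lambda>s. y + integral {0..s} (\<lambda>\<tau>. g \<tau> (z \<tau>))) has_vector_derivative g s (z s)) (at s within {0..T})"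
      using has_vector_derivative_add[OF has_vector_derivative_const integral_has_vector_derivative[OF gz s]] by simp
    then show "(z has_vector_derivative g s (z s)) (at s within {0..T})"
      by (rule has_vector_derivative_transform[OF s, rotated]) (use zeq in auto)
  qed
qed

section \<open>Exceptional null sets and continuity of absolutely continuous arcs\<close>

lemma AE_lebesgue_on_iff_negligible:
  assumes "S \<in> sets lebesgue"
  shows "(AE t in lebesgue_on S. P t) \<longleftrightarrow> (\<exists>N. negligible N \<and> (\<forall>t\<in>S - N. P t))"
proof -
  have "(AE t in lebesgue_on S. P t) \<longleftrightarrow> (AE t in lebesgue. t \<in> S \<longrightarrow> P t)"
    using assms by (intro AE_restrict_space_iff) auto
  also have "\<dots> \<longleftrightarrow> (\<exists>N. negligible N \<and> (\<forall>t\<in>S - N. P t))"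
  proof
    assume "AE t in lebesgue. t \<in> S \<longrightarrow> P t"
    then obtain N where "N \<in> null_sets lebesgue" "{t \<in> space lebesgue. \<not> (t \<in> S \<longrightarrow> P t)} \<subseteq> N"
      by (auto elim: AE_E2 simp: eventually_ae_filter)
    then show "\<exists>N. negligible N \<and> (\<forall>t\<in>S - N. P t)"
      by (auto simp: negligible_iff_null_sets)
  next
    assume "\<exists>N. negligible N \<and> (\<forall>t\<in>S - N. P t)"
    then show "AE t in lebesgue. t \<in> S \<longrightarrow> P t"
      by (auto simp: negligible_iff_null_sets eventually_ae_filter)
  qed
  finally show ?thesis .
qed

lemma AC_imp_continuous_on:
  assumes "absolutely_continuous_on_interval a b f"
  shows "continuous_on {a..b} f"
  unfolding continuous_on_iff
proof (intro ballI allI impI)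
  fix s \<epsilon> :: real assume s: "s \<in> {a..b}" and "\<epsilon> > 0"
  with assms obtain \<delta> where "\<delta> > 0" and d: "\<forall>P :: (real \<times> real) set. finite P \<longrightarrow>
      (\<forall>(u, v)\<in>P. a \<le> u \<and> u \<le> v \<and> v \<le> b) \<longrightarrow>
      disjoint_family_on (\<lambda>(u, v). {u<..<v}) P \<longrightarrow>
      (\<Sum>(u, v)\<in>P. v - u) < \<delta> \<longrightarrow> (\<Sum>(u, v)\<in>P. norm (f v - f u)) < \<epsilon>"
    unfolding absolutely_continuous_on_interval_def by meson
  have "dist (f t) (f s) < \<epsilon>" if t: "t \<in> {a..b}" "dist t s < \<delta>" for t
    using d[rule_format, of "{(min s t, max s t)}"] s t
    by (cases "s \<le> t") (auto simp: disjoint_family_on_def dist_norm norm_minus_commute)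
  with \<open>\<delta> > 0\<close> show "\<exists>d>0. \<forall>x'\<in>{a..b}. dist x' s < d \<longrightarrow> dist (f x') (f s) < \<epsilon>" by blast
qed

subsection \<open>Trajectories and the dynamic programming principle\<close>

text \<open>An absolutely continuous arc is bounded, so the growth condition (F3) bounds its
  velocities. A Lipschitz constant, a null set and two-sided interior derivatives are data that pass
  easily through restriction, shift and concatenation.\<close>

lemma trajectoryE:
  fixes F :: "real^'n \<Rightarrow> (real^'n) set"
  assumes F: "assumption_F F" and y: "trajectory F T a y"
  obtains C N where "C-lipschitz_on {0..T} y" "negligible N"
    "\<forall>s\<in>{0<..<T} - N. \<exists>v\<in>F (y s). (y has_vector_derivative v) (at s)"
proof -
  have ac: "absolutely_continuous_on_interval 0 T y"
    and "AE t in lebesgue_on {0..T}. \<exists>v\<in>F (y t). (y has_vector_derivative v) (at t within {0..T})"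
    using y by (auto simp: trajectory_def)
  then obtain N where N: "negligible N"
    and yN: "\<And>s. s \<in> {0..T} - N \<Longrightarrow> \<exists>v\<in>F (y s). (y has_vector_derivative v) (at s within {0..T})"
    by (auto simp: AE_lebesgue_on_iff_negligible)
  have der: "\<exists>v\<in>F (y s). (y has_vector_derivative v) (at s)" if s: "s \<in> {0<..<T} - N" for s
  proof -
    have "s \<in> {0..T} - N" "at s within {0..T} = at s" using s by (auto simp: at_within_Icc_at)
    then show ?thesis using yN by metis
  qed
  have "bounded (y ` {0..T})"
    by (intro compact_imp_bounded compact_continuous_image AC_imp_continuous_on[OF ac]) simp
  then obtain M where M: "\<And>s. s \<in> {0..T} \<Longrightarrow> norm (y s) \<le> M" by (metis bounded_iff imageI)
  have "\<exists>\<gamma>>0. \<forall>x. \<forall>v\<in>F x. norm v \<le> \<gamma> * (1 + norm x)"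
    using F by (simp add: assumption_F_def)
  then obtain \<gamma> where \<gamma>: "\<gamma> > 0" "\<And>x v. v \<in> F x \<Longrightarrow> norm v \<le> \<gamma> * (1 + norm x)"
    by auto
  have "(\<gamma> * (1 + \<bar>M\<bar>))-lipschitz_on {0..T} y"
  proof (rule AC_bounded_derivative_imp_lipschitz[OF ac N])
    fix s assume s: "s \<in> {0<..<T} - N"
    then obtain v where v: "v \<in> F (y s)" "(y has_vector_derivative v) (at s)" using der by blast
    have "norm v \<le> \<gamma> * (1 + norm (y s))" using \<gamma>(2) v(1) .
    also have "\<dots> \<le> \<gamma> * (1 + \<bar>M\<bar>)" using M[of s] s \<gamma>(1) by (intro mult_left_mono) auto
    finally show "\<exists>d. (y has_vector_derivative d) (at s) \<and> norm d \<le> \<gamma> * (1 + \<bar>M\<bar>)" using v by blast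
  qed (use \<gamma> in auto)
  with N der show thesis by (intro that) auto
qed

lemma trajectoryI:
  assumes "C-lipschitz_on {0..T} y" "y 0 = a" "negligible N"
    and der: "\<And>s. s \<in> {0<..<T} - N \<Longrightarrow> \<exists>v\<in>F (y s). (y has_vector_derivative v) (at s)"
  shows "trajectory F T a y"
proof -
  have "\<exists>v\<in>F (y s). (y has_vector_derivative v) (at s within {0..T})"
    if "s \<in> {0..T} - insert 0 (insert T N)" for s
  proof -
    have "s \<in> {0<..<T} - N" using that by auto
    from der[OF this] show ?thesis by (meson has_vector_derivative_at_within)
  qed
  moreover have "negligible (insert 0 (insert T N))" using assms(3) by simp
  ultimately have "AE s in lebesgue_on {0..T}. \<exists>v\<in>F (y s). (y has_vector_derivative v) (at s within {0..T})"
    unfolding AE_lebesgue_on_iff_negligible[OF lmeasurable_interval(1)[THEN fmeasurableD, unfolded box_real]]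
    by blast
  then show ?thesis using lipschitz_imp_AC[OF assms(1)] assms(2) by (simp add: trajectory_def)
qed

lemma has_vector_derivative_shift:
  fixes w :: "real \<Rightarrow> 'a::real_normed_vector"
  assumes "(w has_vector_derivative v) (at (s + t))"
  shows "((\<lambda>s. w (s + t)) has_vector_derivative v) (at s)"
proof -
  have "((\<lambda>s. s + t) has_vector_derivative 1) (at s)" by (auto intro!: derivative_eq_intros)
  from vector_diff_chain_at[OF this assms] show ?thesis by (simp add: o_def)
qed

lemma lipschitz_on_shift:
  fixes w :: "real \<Rightarrow> 'a::metric_space"
  assumes "C-lipschitz_on {a + t..b + t} w"
  shows "C-lipschitz_on {a..b} (\<lambda>s. w (s + t))"
proof (rule lipschitz_onI)
  show "dist (w (r + t)) (w (s + t)) \<le> C * dist r s" if "r \<in> {a..b}" "s \<in> {a..b}" for r s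
    using lipschitz_onD[OF assms, of "r + t" "s + t"] that by simp
qed (use assms in \<open>rule lipschitz_on_nonneg\<close>)

lemma trajectory_restrict:
  fixes F :: "real^'n \<Rightarrow> (real^'n) set"
  assumes F: "assumption_F F" and y: "trajectory F T a y" and t: "0 \<le> t" "t \<le> T"
  shows "trajectory F t a y"
proof -
  obtain C N where "C-lipschitz_on {0..T} y" "negligible N"
    "\<forall>s\<in>{0<..<T} - N. \<exists>v\<in>F (y s). (y has_vector_derivative v) (at s)"
    using trajectoryE[OF F y] .
  moreover have "y 0 = a" using y by (simp add: trajectory_def)
  ultimately show ?thesis
    using t by (intro trajectoryI[of C t y a N]) (auto intro: lipschitz_on_subset)
qed

lemma trajectory_shift:
  fixes F :: "real^'n \<Rightarrow> (real^'n) set"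
  assumes F: "assumption_F F" and y: "trajectory F T a y" and t: "0 \<le> t" "t \<le> T"
  shows "trajectory F (T - t) (y t) (\<lambda>s. y (s + t))"
proof -
  obtain C N where y': "C-lipschitz_on {0..T} y" "negligible N"
    "\<forall>s\<in>{0<..<T} - N. \<exists>v\<in>F (y s). (y has_vector_derivative v) (at s)"
    using trajectoryE[OF F y] .
  show ?thesis
  proof (rule trajectoryI)
    show "C-lipschitz_on {0..T - t} (\<lambda>s. y (s + t))"
      using t by (intro lipschitz_on_shift lipschitz_on_subset[OF y'(1)]) auto
    show "negligible ((+) (- t) ` N)" using y'(2) by (rule negligible_translation)
    fix s assume s: "s \<in> {0<..<T - t} - (+) (- t) ` N"
    have "s + t \<notin> N"
    proof
      assume "s + t \<in> N"
      then have "- t + (s + t) \<in> (+) (- t) ` N" by blast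
      with s show False by simp
    qed
    with s t have "s + t \<in> {0<..<T} - N" by auto
    from y'(3)[rule_format, OF this] show "\<exists>v\<in>F (y (s + t)). ((\<lambda>s. y (s + t)) has_vector_derivative v) (at s)"
      using has_vector_derivative_shift by blast
  qed simp
qed

lemma trajectory_concat:
  fixes F :: "real^'n \<Rightarrow> (real^'n) set"
  assumes F: "assumption_F F" and y: "trajectory F t a y" and w: "trajectory F \<tau> (y t) w"
    and t: "0 \<le> t" "0 \<le> \<tau>"
  shows "trajectory F (t + \<tau>) a (\<lambda>s. if s \<le> t then y s else w (s - t))"
proof -
  obtain C N where y': "C-lipschitz_on {0..t} y" "negligible N"
    "\<forall>s\<in>{0<..<t} - N. \<exists>v\<in>F (y s). (y has_vector_derivative v) (at s)"
    using trajectoryE[OF F y] .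
  obtain D M where w': "D-lipschitz_on {0..\<tau>} w" "negligible M"
    "\<forall>s\<in>{0<..<\<tau>} - M. \<exists>v\<in>F (w s). (w has_vector_derivative v) (at s)"
    using trajectoryE[OF F w] .
  let ?q = "\<lambda>s. if s \<le> t then y s else w (s - t)"
  show ?thesis
  proof (rule trajectoryI)
    have "D-lipschitz_on {t..t + \<tau>} (\<lambda>s. w (s - t))"
      using lipschitz_on_shift[of D t "- t" "t + \<tau>" w] w'(1) by simp
    then have "(max C D)-lipschitz_on {t..t + \<tau>} (\<lambda>s. w (s - t))"
      by (rule lipschitz_on_mono) auto
    moreover have "(max C D)-lipschitz_on {0..t} y" using y'(1) by (rule lipschitz_on_mono) auto
    ultimately show "(max C D)-lipschitz_on {0..t + \<tau>} ?q"
      by (intro lipschitz_on_concat) (use w in \<open>auto simp: trajectory_def\<close>)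
    show "?q 0 = a" using y t by (simp add: trajectory_def)
    \<comment> \<open>The one-sided velocities at the junction need not agree, so \<open>t\<close>
      becomes exceptional.\<close>
    show "negligible (N \<union> insert t ((+) t ` M))"
      using y'(2) negligible_translation[OF w'(2)] by simp
    fix s assume s: "s \<in> {0<..<t + \<tau>} - (N \<union> insert t ((+) t ` M))"
    show "\<exists>v\<in>F (?q s). (?q has_vector_derivative v) (at s)"
    proof (cases "s < t")
      case True
      with s obtain v where v: "v \<in> F (y s)" "(y has_vector_derivative v) (at s)"
        using y'(3)[rule_format, of s] by auto
      have "(?q has_vector_derivative v) (at s)"
        by (rule has_vector_derivative_transform_within_open[OF v(2), of "{..<t}"]) (use True in auto)
      with v(1) True show ?thesis by auto
    next
      case False
      with s have st: "s > t" by auto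
      have "s - t \<notin> M"
      proof
        assume "s - t \<in> M"
        then have "t + (s - t) \<in> (+) t ` M" by blast
        with s show False by simp
      qed
      with s st obtain v where v: "v \<in> F (w (s - t))" "(w has_vector_derivative v) (at (s - t))"
        using w'(3)[rule_format, of "s - t"] by auto
      then have "((\<lambda>s. w (s - t)) has_vector_derivative v) (at s)"
        using has_vector_derivative_shift[of w v s "- t"] by simp
      then have "(?q has_vector_derivative v) (at s)"
        by (rule has_vector_derivative_transform_within_open[of _ _ _ "{t<..}"]) (use st in auto)
      with v(1) st show ?thesis by auto
    qed
  qed
qed

section \<open>The minimum time function along trajectories\<close>

lemma min_time_nonneg: "0 \<le> min_time F K a"
  unfolding min_time_def by (auto intro!: Inf_greatest)

lemma min_time_le:
  assumes "0 < T" "trajectory F T a y" "y T \<in> K"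
  shows "min_time F K a \<le> ereal T"
  unfolding min_time_def using assms by (auto intro!: Inf_lower)

text \<open>Every route from \<open>y t\<close> to the target can be appended to \<open>y\<close>.
  The cases \<open>t = 0\<close> and \<open>y t \<in> K\<close> stand apart because the infimum runs
  over positive times only and the value on the target is set by definition.\<close>

lemma min_time_le_trajectory:
  fixes F :: "real^'n \<Rightarrow> (real^'n) set"
  assumes F: "assumption_F F" and t: "0 \<le> t" and y: "trajectory F t a y"
  shows "min_time F K a \<le> ereal t + min_time F K (y t)"
proof (cases "t = 0")
  case True
  with y show ?thesis by (simp add: trajectory_def flip: zero_ereal_def)
next
  case False
  with t have t: "0 < t" by simp
  show ?thesis
  proof (cases "y t \<in> K")
    case True
    then have "min_time F K (y t) = 0" by (simp add: min_time_def)
    with min_time_le[OF t y True] show ?thesis by simp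
  next
    case False
    \<comment> \<open>With the finite \<open>t\<close> moved to the left, the claim is a lower bound
      for an infimum, which also covers an empty set of routes.\<close>
    have "min_time F K a - ereal t \<le> min_time F K (y t)"
    proof -
      have "min_time F K a - ereal t \<le> ereal T" if T: "0 < T" "trajectory F T (y t) w" "w T \<in> K" for T w
      proof -
        let ?q = "\<lambda>s. if s \<le> t then y s else w (s - t)"
        have "trajectory F (t + T) a ?q" using trajectory_concat[OF F y T(2)] t T(1) by simp
        then have "min_time F K a \<le> ereal (t + T)"
          using t T by (intro min_time_le[of _ F a ?q]) auto
        then show ?thesis by (simp add: ereal_minus_le_iff add.commute)
      qed
      then show ?thesis using False by (auto simp: min_time_def[of F K "y t"] intro!: Inf_greatest)
    qed
    then show ?thesis by (simp add: ereal_minus_le_iff add.commute)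
  qed
qed

text \<open>The tail of the optimal trajectory reaches the target in time \<open>T - t\<close>; a
  faster route from \<open>x t\<close> would beat \<open>T\<close> from \<open>x0\<close>.\<close>

lemma min_time_along_optimal:
  fixes F :: "real^'n \<Rightarrow> (real^'n) set"
  assumes F: "assumption_F F" and x: "trajectory F T x0 x" "x T \<in> K"
    and T: "min_time F K x0 = ereal T" and t: "t \<in> {0..T}"
  shows "min_time F K (x t) = ereal (T - t)"
proof (rule antisym)
  show "min_time F K (x t) \<le> ereal (T - t)"
  proof (cases "t = T")
    case True with x show ?thesis by (simp add: min_time_def)
  next
    case False
    with t have "0 < T - t" by auto
    moreover have "trajectory F (T - t) (x t) (\<lambda>s. x (s + t))"
      using trajectory_shift[OF F x(1)] t by simp
    ultimately show ?thesis using x(2) by (intro min_time_le[where y = "\<lambda>s. x (s + t)"]) auto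
  qed
  have "ereal T \<le> ereal t + min_time F K (x t)"
    unfolding T[symmetric] using t by (intro min_time_le_trajectory[OF F] trajectory_restrict[OF F x(1)]) auto
  then show "ereal (T - t) \<le> min_time F K (x t)"
    by (cases "min_time F K (x t)") auto
qed

subsection \<open>Clarke gradients of semiconvex functions\<close>

text \<open>A directional derivative as the limit of a sequence lets inequalities pass to the limit
  by order alone. Steps by powers of \<open>1 / 2\<close> fit the midpoint form of
  semiconvexity.\<close>

lemma GDERIV_dyadic_quotient:
  fixes f :: "'a::real_inner \<Rightarrow> real"
  assumes "GDERIV f y :> g"
  shows "(\<lambda>k. 2 ^ k * (f (y + (1 / 2) ^ k *\<^sub>R d) - f y)) \<longlonglongrightarrow> d \<bullet> g"
proof -
  have l: "((\<lambda>t. y + t *\<^sub>R d) has_derivative (\<lambda>t. t *\<^sub>R d)) (at (0::real))"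
    by (auto intro!: derivative_eq_intros)
  have "(f has_derivative (\<lambda>h. h \<bullet> g)) (at (y + 0 *\<^sub>R d))"
    using assms by (simp add: gderiv_def)
  from has_derivative_compose[OF l this]
  have "((\<lambda>t. f (y + t *\<^sub>R d)) has_real_derivative d \<bullet> g) (at 0)"
    unfolding has_field_derivative_def by (rule has_derivative_eq_rhs) auto
  then have lim: "((\<lambda>h. (f (y + h *\<^sub>R d) - f y) / h) \<longlongrightarrow> d \<bullet> g) (at 0)"
    by (simp add: DERIV_def)
  have "filterlim (\<lambda>k. (1 / 2 :: real) ^ k) (at 0) sequentially"
    by (auto simp: filterlim_at intro!: LIMSEQ_realpow_zero)
  from filterlim_compose[OF lim this] show ?thesis
    by (simp add: power_one_over field_simps)
qed

lemma eventually_dyadic_in_open: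
  fixes y d :: "'a::real_normed_vector"
  assumes "open S" "y \<in> S"
  shows "\<forall>\<^sub>F k in sequentially. y + (1 / 2 :: real) ^ k *\<^sub>R d \<in> S"
proof -
  have "(\<lambda>k. y + (1 / 2 :: real) ^ k *\<^sub>R d) \<longlonglongrightarrow> y + 0 *\<^sub>R d"
    by (intro tendsto_intros LIMSEQ_realpow_zero) auto
  then show ?thesis using topological_tendstoD[of _ "y + 0 *\<^sub>R d"] assms by auto
qed

text \<open>In the direction \<open>g\<close> itself the derivative is \<open>|g|^2\<close>, while
  the one-sided Lipschitz bound caps the quotients by \<open>K |g|\<close>.\<close>

lemma GDERIV_norm_le:
  fixes f :: "'a::real_inner \<Rightarrow> real"
  assumes S: "open S" "y \<in> S" and lip: "\<And>z. z \<in> S \<Longrightarrow> f z - f y \<le> K * norm (z - y)"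
    and g: "GDERIV f y :> g" and K: "0 \<le> K"
  shows "norm g \<le> K"
proof -
  have "g \<bullet> g \<le> K * norm g"
  proof (rule tendsto_upperbound[OF GDERIV_dyadic_quotient[OF g, of g]])
    show "\<forall>\<^sub>F k in sequentially. 2 ^ k * (f (y + (1 / 2) ^ k *\<^sub>R g) - f y) \<le> K * norm g"
      using eventually_dyadic_in_open[OF S, of g]
    proof eventually_elim
      case (elim k)
      from lip[OF this] have "2 ^ k * (f (y + (1 / 2) ^ k *\<^sub>R g) - f y) \<le> 2 ^ k * (K * ((1 / 2) ^ k * norm g))"
        by (intro mult_left_mono) auto
      also have "\<dots> = K * norm g" by (simp add: power_one_over)
      finally show ?case .
    qed
  qed simp
  then have "norm g * norm g \<le> K * norm g" by (simp add: dot_square_norm power2_eq_square)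
  then show ?thesis using K by (cases "g = 0") auto
qed

lemma clarke_gradient_norm_le:
  fixes f :: "'a::real_inner \<Rightarrow> real"
  assumes S: "open S" "x \<in> S" and lip: "\<And>y z. y \<in> S \<Longrightarrow> z \<in> S \<Longrightarrow> f z - f y \<le> K * norm (z - y)"
    and K: "0 \<le> K" and w: "w \<in> clarke_gradient f x"
  shows "norm w \<le> K"
proof -
  have "clarke_gradient f x \<subseteq> cball 0 K"
    unfolding clarke_gradient_def
  proof (rule hull_minimal; clarify?)
    fix v y and g :: "nat \<Rightarrow> 'a"
    assume y: "y \<longlonglongrightarrow> x" and g: "\<forall>i. GDERIV f (y i) :> g i" "g \<longlonglongrightarrow> v"
    have "\<forall>\<^sub>F i in sequentially. y i \<in> S" using topological_tendstoD[OF y S] .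
    then have "\<forall>\<^sub>F i in sequentially. norm (g i) \<le> K"
      by eventually_elim (use GDERIV_norm_le[OF S(1)] lip g(1) K in blast)
    from tendsto_upperbound[OF tendsto_norm[OF g(2)] this]
    show "v \<in> cball 0 K" by simp
  qed
  with w show ?thesis by auto
qed

text \<open>Iterating the semiconvexity inequality along the dyadic points \<open>y + 2^-k (z - y)\<close>
  gives the first-order inequality directly, without passing through convexity.\<close>

lemma semiconvex_GDERIV_le:
  fixes f :: "'a::real_inner \<Rightarrow> real"
  assumes S: "convex S" "y \<in> S" "z \<in> S"
    and sc: "\<And>x k. closed_segment (x - k) (x + k) \<subseteq> S \<Longrightarrow> f (x + k) + f (x - k) - 2 * f x \<ge> - C * (norm k)\<^sup>2"
    and g: "GDERIV f y :> g" and C: "0 \<le> C"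
  shows "(z - y) \<bullet> g \<le> f z - f y + C * (norm (z - y))\<^sup>2"
proof -
  define d where "d = z - y"
  define \<phi> where "\<phi> k = 2 ^ k * (f (y + (1 / 2) ^ k *\<^sub>R d) - f y)" for k
  \<comment> \<open>Semiconvexity is applied at the midpoint \<open>y + h d\<close> of the segment
    from \<open>y\<close> to \<open>y + 2 h d\<close>. Multiplied by \<open>2 ^ k\<close>, the
    quadratic error leaves a summable power.\<close>
  have step: "\<phi> (Suc k) \<le> \<phi> k + C * (norm d)\<^sup>2 * (1 / 2) ^ (k + 2)" for k
  proof -
    define h where "h = (1 / 2 :: real) ^ Suc k"
    have h: "0 < h" "2 * h \<le> 1" by (auto simp: h_def power_le_one)
    have e: "y + h *\<^sub>R d - h *\<^sub>R d = y" "y + h *\<^sub>R d + h *\<^sub>R d = y + (1 / 2) ^ k *\<^sub>R d"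
      by (auto simp: h_def simp flip: scaleR_add_left)
    have "y + (1 / 2) ^ k *\<^sub>R d \<in> closed_segment y z"
      unfolding closed_segment_def
      by (auto intro!: exI[of _ "(1 / 2) ^ k"] simp: d_def algebra_simps power_le_one)
    then have m: "y + (1 / 2) ^ k *\<^sub>R d \<in> S" using S by (meson closed_segment_subset subsetD)
    have "closed_segment (y + h *\<^sub>R d - h *\<^sub>R d) (y + h *\<^sub>R d + h *\<^sub>R d) \<subseteq> S"
      unfolding e using S(1,2) m by (intro closed_segment_subset)
    from sc[OF this] have "f (y + (1 / 2) ^ k *\<^sub>R d) + f y - 2 * f (y + h *\<^sub>R d) \<ge> - C * (h * norm d)\<^sup>2"
      unfolding e using h(1) by simp
    then have "2 ^ k * (- C * (h * norm d)\<^sup>2) \<le> 2 ^ k * (f (y + (1 / 2) ^ k *\<^sub>R d) + f y - 2 * f (y + h *\<^sub>R d))"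
      by (intro mult_left_mono) auto
    also have "\<dots> = \<phi> k - \<phi> (Suc k)" by (simp add: \<phi>_def h_def algebra_simps)
    finally have "\<phi> (Suc k) \<le> \<phi> k + 2 ^ k * (C * (h * norm d)\<^sup>2)" by simp
    also have "2 ^ k * (C * (h * norm d)\<^sup>2) = C * (norm d)\<^sup>2 * (1 / 2) ^ (k + 2)"
      by (simp add: h_def power_mult_distrib power2_eq_square power_one_over field_simps)
    finally show ?thesis .
  qed
  have "\<phi> k \<le> \<phi> 0 + C * (norm d)\<^sup>2 * (1 - (1 / 2) ^ k)" for k
  proof (induction k)
    case (Suc k)
    \<comment> \<open>Giving away a factor of two in the error makes the partial sums exactly
      \<open>1 - (1 / 2) ^ k\<close>, the closed form carried by the induction.\<close>
    have "(1 / 2 :: real) ^ (k + 2) \<le> (1 / 2) ^ Suc k" by simp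
    then have "C * (norm d)\<^sup>2 * (1 / 2) ^ (k + 2) \<le> C * (norm d)\<^sup>2 * (1 / 2) ^ Suc k"
      using C by (intro mult_left_mono) auto
    then have "\<phi> (Suc k) \<le> \<phi> 0 + C * (norm d)\<^sup>2 * (1 - (1 / 2) ^ k) + C * (norm d)\<^sup>2 * (1 / 2) ^ Suc k"
      using step[of k] Suc by linarith
    also have "\<dots> = \<phi> 0 + C * (norm d)\<^sup>2 * (1 - (1 / 2) ^ Suc k)" by (simp add: algebra_simps)
    finally show ?case .
  qed simp
  moreover have "C * (norm d)\<^sup>2 * (1 - (1 / 2) ^ k) \<le> C * (norm d)\<^sup>2" for k
    using C by (intro mult_left_le) auto
  ultimately have "\<phi> k \<le> \<phi> 0 + C * (norm d)\<^sup>2" for k by (meson add_left_mono order_trans)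
  moreover have "\<phi> \<longlonglongrightarrow> d \<bullet> g" unfolding \<phi>_def by (rule GDERIV_dyadic_quotient[OF g])
  ultimately have "d \<bullet> g \<le> \<phi> 0 + C * (norm d)\<^sup>2" by (intro LIMSEQ_le_const2) auto
  then show ?thesis by (simp add: \<phi>_def d_def)
qed

text \<open>For fixed \<open>z\<close> the inequality is affine in \<open>w\<close> and describes a
  half-space, which is convex; so it needs checking only on limits of gradients, and there it
  follows from the gradient inequality at \<open>y i\<close> by continuity of
  \<open>f\<close>.\<close>

lemma semiconvex_clarke_le:
  fixes f :: "'a::real_inner \<Rightarrow> real"
  assumes S: "open S" "convex S" "x \<in> S" "z \<in> S" and f: "continuous_on S f"
    and sc: "\<And>x k. closed_segment (x - k) (x + k) \<subseteq> S \<Longrightarrow> f (x + k) + f (x - k) - 2 * f x \<ge> - C * (norm k)\<^sup>2"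
    and C: "0 \<le> C" and w: "w \<in> clarke_gradient f x"
  shows "(z - x) \<bullet> w \<le> f z - f x + C * (norm (z - x))\<^sup>2"
proof -
  let ?H = "{v. (z - x) \<bullet> v \<le> f z - f x + C * (norm (z - x))\<^sup>2}"
  have "clarke_gradient f x \<subseteq> ?H"
    unfolding clarke_gradient_def
  proof (rule hull_minimal; clarify?)
    fix v y and g :: "nat \<Rightarrow> 'a"
    assume y: "y \<longlonglongrightarrow> x" and g: "\<forall>i. GDERIV f (y i) :> g i" "g \<longlonglongrightarrow> v"
    have ev: "\<forall>\<^sub>F i in sequentially. y i \<in> S" using topological_tendstoD[OF y S(1,3)] .
    then have le: "\<forall>\<^sub>F i in sequentially. (z - y i) \<bullet> g i \<le> f z - f (y i) + C * (norm (z - y i))\<^sup>2"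
      by eventually_elim (use semiconvex_GDERIV_le[OF S(2) _ S(4) sc _ C] g(1) in blast)
    have "isCont f x" using f S by (simp add: continuous_on_eq_continuous_at)
    then have "(\<lambda>i. f (y i)) \<longlonglongrightarrow> f x" using y by (rule isCont_tendsto_compose)
    then have lim2: "(\<lambda>i. f z - f (y i) + C * (norm (z - y i))\<^sup>2) \<longlonglongrightarrow> f z - f x + C * (norm (z - x))\<^sup>2"
      using y by (intro tendsto_intros)
    have lim1: "(\<lambda>i. (z - y i) \<bullet> g i) \<longlonglongrightarrow> (z - x) \<bullet> v"
      using y g(2) by (intro tendsto_intros)
    from tendsto_le[OF _ lim2 lim1 le] show "(z - x) \<bullet> v \<le> f z - f x + C * (norm (z - x))\<^sup>2" by simp
  qed (rule convex_halfspace_le)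
  with w show ?thesis by auto
qed

subsection \<open>The Hamiltonian\<close>

lemma max_hamiltonian_ge:
  fixes F :: "real^'n \<Rightarrow> (real^'n) set"
  assumes "assumption_F F" "v \<in> F x"
  shows "v \<bullet> p \<le> max_hamiltonian F x p"
  using max_hamiltonian_attained[OF assms(1), of x p] assms(2) by auto

text \<open>By (F2) a maximiser at \<open>x\<close> is a point of \<open>F y\<close> up to an error
  proportional to \<open>|x - y|\<close>. The factor \<open>norm p\<close> is essential: it later
  makes the costate inclusion linearly bounded, as Gronwall requires.\<close>

lemma max_hamiltonian_lipschitz_state:
  fixes F :: "real^'n \<Rightarrow> (real^'n) set"
  assumes F: "assumption_F F"
  obtains L where "L > 0" "\<And>x y p. x \<in> cball 0 r \<Longrightarrow> y \<in> cball 0 r \<Longrightarrow>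
      max_hamiltonian F x p - max_hamiltonian F y p \<le> L * norm p * norm (x - y)"
proof -
  have "compact (cball (0::real^'n) r)" by simp
  with F obtain L where L: "L > 0" "\<And>x y. x \<in> cball 0 r \<Longrightarrow> y \<in> cball 0 r \<Longrightarrow>
      F x \<subseteq> {v + (L * norm (y - x)) *\<^sub>R b |v b. v \<in> F y \<and> b \<in> cball 0 1}"
    unfolding assumption_F_def by meson
  show thesis
  proof
    fix x y p :: "real^'n" assume xy: "x \<in> cball 0 r" "y \<in> cball 0 r"
    obtain v where v: "v \<in> F x" "max_hamiltonian F x p = v \<bullet> p"
      using max_hamiltonian_attained[OF F] by blast
    obtain u b where ub: "v = u + (L * norm (y - x)) *\<^sub>R b" "u \<in> F y" "norm b \<le> 1"
      using L(2)[OF xy] v(1) by auto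
    have "b \<bullet> p \<le> norm p"
      using norm_cauchy_schwarz[of b p] mult_right_mono[OF ub(3), of "norm p"] by simp
    then have "L * norm (y - x) * (b \<bullet> p) \<le> L * norm (y - x) * norm p"
      using L(1) by (intro mult_left_mono) auto
    moreover have "u \<bullet> p \<le> max_hamiltonian F y p" using max_hamiltonian_ge[OF F ub(2)] .
    ultimately show "max_hamiltonian F x p - max_hamiltonian F y p \<le> L * norm p * norm (x - y)"
      unfolding v(2) ub(1) by (simp add: inner_add_left norm_minus_commute mult_ac)
  qed (rule L(1))
qed

lemma max_hamiltonian_lipschitz_costate:
  fixes F :: "real^'n \<Rightarrow> (real^'n) set"
  assumes F: "assumption_F F"
  obtains B where "B > 0" "\<And>p q. \<bar>max_hamiltonian F x p - max_hamiltonian F x q\<bar> \<le> B * norm (p - q)"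
proof -
  have "\<exists>\<gamma>>0. \<forall>x. \<forall>v\<in>F x. norm v \<le> \<gamma> * (1 + norm x)"
    using F by (simp add: assumption_F_def)
  then obtain \<gamma> where \<gamma>: "\<gamma> > 0" "\<And>v. v \<in> F x \<Longrightarrow> norm v \<le> \<gamma> * (1 + norm x)"
    by auto
  have le: "max_hamiltonian F x p - max_hamiltonian F x q \<le> \<gamma> * (1 + norm x) * norm (p - q)" for p q
  proof -
    obtain v where v: "v \<in> F x" "max_hamiltonian F x p = v \<bullet> p"
      using max_hamiltonian_attained[OF F] by blast
    have "v \<bullet> p - v \<bullet> q \<le> norm v * norm (p - q)"
      unfolding inner_diff_right[symmetric] by (rule norm_cauchy_schwarz)
    also have "\<dots> \<le> \<gamma> * (1 + norm x) * norm (p - q)" using \<gamma>(2)[OF v(1)] by (intro mult_right_mono) auto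
    finally show ?thesis using v(2) max_hamiltonian_ge[OF F v(1), of q] by linarith
  qed
  show thesis
  proof
    show "\<gamma> * (1 + norm x) > 0" using \<gamma>(1) norm_ge_zero[of x] by (intro mult_pos_pos) linarith+
    show "\<bar>max_hamiltonian F x p - max_hamiltonian F x q\<bar> \<le> \<gamma> * (1 + norm x) * norm (p - q)" for p q
      using le[of p q] le[of q p] by (simp add: norm_minus_commute abs_le_iff)
  qed
qed

lemma continuous_on_max_hamiltonian_costate:
  fixes F :: "real^'n \<Rightarrow> (real^'n) set"
  assumes F: "assumption_F F"
  shows "continuous_on S (max_hamiltonian F x)"
proof -
  obtain B where B: "B > 0" "\<And>p q. \<bar>max_hamiltonian F x p - max_hamiltonian F x q\<bar> \<le> B * norm (p - q)"
    using max_hamiltonian_lipschitz_costate[OF F, of x thesis] by blast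
  have "B-lipschitz_on S (max_hamiltonian F x)"
    using B by (intro lipschitz_onI) (auto simp: dist_norm)
  then show ?thesis by (rule lipschitz_on_continuous_on)
qed

text \<open>The linear function \<open>q \<mapsto> w \<bullet> q\<close> lies below
  \<open>H(x, q)\<close> and touches it at \<open>p\<close>, so its slope must be the gradient
  there; the direction \<open>w - v\<close> exposes any difference.\<close>

lemma GDERIV_max_hamiltonian_eq:
  fixes F :: "real^'n \<Rightarrow> (real^'n) set"
  assumes F: "assumption_F F" and v: "GDERIV (max_hamiltonian F x) p :> v"
    and w: "w \<in> F x" "w \<bullet> p = max_hamiltonian F x p"
  shows "w = v"
proof -
  let ?d = "w - v"
  have "?d \<bullet> w \<le> ?d \<bullet> v"
  proof (rule LIMSEQ_le_const[OF GDERIV_dyadic_quotient[OF v, of ?d]], intro exI allI impI)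
    fix k :: nat
    have "(1 / 2) ^ k * (?d \<bullet> w) \<le> max_hamiltonian F x (p + (1 / 2) ^ k *\<^sub>R ?d) - max_hamiltonian F x p"
      using max_hamiltonian_ge[OF F w(1), of "p + (1 / 2) ^ k *\<^sub>R ?d"] w(2)
      by (simp add: inner_add_right inner_commute)
    then have "2 ^ k * ((1 / 2) ^ k * (?d \<bullet> w)) \<le> 2 ^ k * (max_hamiltonian F x (p + (1 / 2) ^ k *\<^sub>R ?d) - max_hamiltonian F x p)"
      by (intro mult_left_mono) auto
    then show "?d \<bullet> w \<le> 2 ^ k * (max_hamiltonian F x (p + (1 / 2) ^ k *\<^sub>R ?d) - max_hamiltonian F x p)"
      by (simp add: power_one_over)
  qed
  then have "?d \<bullet> ?d \<le> 0" by (simp add: inner_diff_right)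
  then show ?thesis using inner_gt_zero_iff[of ?d] inner_ge_zero[of ?d] by (metis eq_iff_diff_eq_0 not_le)
qed

text \<open>A choice is total, with a value also at \<open>p = 0\<close>, and the value is always in
  \<open>F x\<close>. An arc driven by this field is therefore a trajectory without any
  differentiability of the Hamiltonian.\<close>

definition velocity :: "(real^'n \<Rightarrow> (real^'n) set) \<Rightarrow> real^'n \<Rightarrow> real^'n \<Rightarrow> real^'n" where
  "velocity F x p = (SOME v. v \<in> F x \<and> v \<bullet> p = max_hamiltonian F x p)"

text \<open>For \<open>p \<noteq> 0\<close> assumption (H) makes the maximiser unique and equal to \<open>\<nabla>\<^sub>p H(x, p)\<close>.\<close>

lemma velocity:
  fixes F :: "real^'n \<Rightarrow> (real^'n) set"
  assumes F: "assumption_F F"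
  shows "velocity F x p \<in> F x" "velocity F x p \<bullet> p = max_hamiltonian F x p"
proof -
  have "\<exists>v. v \<in> F x \<and> v \<bullet> p = max_hamiltonian F x p"
    using max_hamiltonian_attained[OF F, of x p] by auto
  from someI_ex[OF this] show "velocity F x p \<in> F x" "velocity F x p \<bullet> p = max_hamiltonian F x p"
    unfolding velocity_def by auto
qed

lemma GDERIV_max_hamiltonian_velocity:
  fixes F :: "real^'n \<Rightarrow> (real^'n) set"
  assumes "assumption_F F" "GDERIV (max_hamiltonian F x) p :> v"
  shows "v = velocity F x p"
  using GDERIV_max_hamiltonian_eq[OF assms velocity[OF assms(1)]] by simp

text \<open>(H2) gives a gradient map for each \<open>p\<close> separately, with one constant for
  all. Uniqueness of the maximiser identifies these maps with the single field
  \<open>velocity F\<close>.\<close>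

lemma velocity_lipschitz:
  fixes F :: "real^'n \<Rightarrow> (real^'n) set"
  assumes F: "assumption_F F" and H: "assumption_H F" and r: "r > 0"
  obtains L where "L > 0" "\<And>p x y. p \<noteq> 0 \<Longrightarrow> x \<in> ball 0 r \<Longrightarrow> y \<in> ball 0 r \<Longrightarrow>
    norm (velocity F x p - velocity F y p) \<le> L * norm (x - y)"
proof -
  obtain L where L: "\<And>p. p \<noteq> 0 \<Longrightarrow> \<exists>G. (\<forall>x\<in>ball 0 r. GDERIV (max_hamiltonian F x) p :> G x) \<and> L-lipschitz_on (ball 0 r) G"
    using H r unfolding assumption_H_def by meson
  show thesis
  proof
    \<comment> \<open>A strictly positive constant is wanted because the weight in the Picard
      argument divides by it.\<close>
    show "\<bar>L\<bar> + 1 > 0" by simp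
    fix p x y :: "real^'n" assume p: "p \<noteq> 0" and xy: "x \<in> ball 0 r" "y \<in> ball 0 r"
    from L[OF p] obtain G where G: "\<forall>x\<in>ball 0 r. GDERIV (max_hamiltonian F x) p :> G x" "L-lipschitz_on (ball 0 r) G"
      by blast
    have "velocity F x p = G x" "velocity F y p = G y"
      using G(1) xy GDERIV_max_hamiltonian_velocity[OF F] by metis+
    with lipschitz_on_normD[OF G(2) xy] have "norm (velocity F x p - velocity F y p) \<le> L * norm (x - y)" by simp
    also have "\<dots> \<le> (\<bar>L\<bar> + 1) * norm (x - y)" by (intro mult_right_mono) auto
    finally show "norm (velocity F x p - velocity F y p) \<le> (\<bar>L\<bar> + 1) * norm (x - y)" .
  qed
qed

lemma velocity_unique:
  fixes F :: "real^'n \<Rightarrow> (real^'n) set"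
  assumes F: "assumption_F F" and H: "assumption_H F" and p: "p \<noteq> 0"
    and w: "w \<in> F x" "w \<bullet> p = max_hamiltonian F x p"
  shows "w = velocity F x p"
proof -
  have r: "norm x + 1 > 0" "x \<in> ball 0 (norm x + 1)" using norm_ge_zero[of x] by (linarith, simp)
  then obtain v where "GDERIV (max_hamiltonian F x) p :> v"
    using H p unfolding assumption_H_def by meson
  then show ?thesis
    using GDERIV_max_hamiltonian_eq[OF F _ w] GDERIV_max_hamiltonian_velocity[OF F] by metis
qed

text \<open>A single-valued closed graph in the compact set \<open>F x\<close> forces continuity.\<close>

lemma continuous_on_velocity_costate:
  fixes F :: "real^'n \<Rightarrow> (real^'n) set"
  assumes F: "assumption_F F" and H: "assumption_H F"
  shows "continuous_on (- {0}) (velocity F x)"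
proof -
  have c: "compact (F x)" using F by (simp add: assumption_F_def)
  have fim: "velocity F x \<in> - {0} \<rightarrow> F x" using velocity(1)[OF F] by auto
  let ?W = "(- {0}) \<times> F x"
  have "(\<lambda>p. (p, velocity F x p)) ` (- {0}) = {z \<in> ?W. snd z \<bullet> fst z - max_hamiltonian F x (fst z) = 0}"
    using velocity[OF F] velocity_unique[OF F H] by (auto simp: image_iff)
  moreover have "continuous_on ?W (\<lambda>z. snd z \<bullet> fst z - max_hamiltonian F x (fst z))"
    by (intro continuous_intros continuous_on_compose2[OF continuous_on_max_hamiltonian_costate[OF F, of UNIV]]) auto
  ultimately have "closedin (top_of_set ?W) ((\<lambda>p. (p, velocity F x p)) ` (- {0}))"
    by (simp only: continuous_closedin_preimage_constant)
  then show ?thesis using continuous_closed_graph_eq[OF c fim] by simp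
qed

text \<open>The bound from (F2) is local, while \<open>continuous_on_along_arc\<close> compares
  arbitrary states. Projecting onto a ball that contains the arc makes the bound global and changes
  nothing along \<open>x\<close>.\<close>

lemma continuous_on_max_hamiltonian_arc:
  fixes F :: "real^'n \<Rightarrow> (real^'n) set"
  assumes F: "assumption_F F" and x: "continuous_on {a..b} x" and p: "continuous_on {a..b::real} p"
  shows "continuous_on {a..b} (\<lambda>s. max_hamiltonian F (x s) (p s))"
proof -
  have "bounded (x ` {a..b})" "bounded (p ` {a..b})"
    using x p by (auto intro!: compact_imp_bounded compact_continuous_image)
  then obtain M P where M: "\<And>s. s \<in> {a..b} \<Longrightarrow> norm (x s) \<le> M" and P: "\<And>s. s \<in> {a..b} \<Longrightarrow> norm (p s) \<le> P"
    by (metis bounded_iff imageI)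
  define \<pi> where "\<pi> = closest_point (cball (0::real^'n) \<bar>M\<bar>)"
  have \<pi>: "\<pi> \<xi> \<in> cball 0 \<bar>M\<bar>" for \<xi> unfolding \<pi>_def by (intro closest_point_in_set) auto
  have \<pi>l: "norm (\<pi> \<xi> - \<pi> \<eta>) \<le> norm (\<xi> - \<eta>)" for \<xi> \<eta>
    unfolding \<pi>_def dist_norm[symmetric] by (intro closest_point_lipschitz) auto
  obtain L where L: "L > 0" "\<And>x y p. x \<in> cball 0 \<bar>M\<bar> \<Longrightarrow> y \<in> cball 0 \<bar>M\<bar> \<Longrightarrow>
      max_hamiltonian F x p - max_hamiltonian F y p \<le> L * norm p * norm (x - y)"
    using max_hamiltonian_lipschitz_state[OF F] by metis
  have c: "continuous_on {a..b} (\<lambda>s. max_hamiltonian F (\<pi> (x s)) (p s))"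
  proof (rule continuous_on_along_arc[OF _ _ x])
    fix s and \<xi> \<eta> :: "real^'n" assume s: "s \<in> {a..b}"
    have "norm (max_hamiltonian F (\<pi> \<xi>) (p s) - max_hamiltonian F (\<pi> \<eta>) (p s)) \<le> L * norm (p s) * norm (\<pi> \<xi> - \<pi> \<eta>)"
      using L(2)[OF \<pi>[of \<xi>] \<pi>[of \<eta>], of "p s"] L(2)[OF \<pi>[of \<eta>] \<pi>[of \<xi>], of "p s"]
      by (simp add: abs_le_iff norm_minus_commute)
    also have "\<dots> \<le> L * P * norm (\<xi> - \<eta>)"
      using P[OF s] order_trans[OF norm_ge_zero P[OF s]] L(1) \<pi>l by (intro mult_mono) auto
    finally show "norm (max_hamiltonian F (\<pi> \<xi>) (p s) - max_hamiltonian F (\<pi> \<eta>) (p s)) \<le> L * P * norm (\<xi> - \<eta>)" .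
  next
    show "continuous_on {a..b} (\<lambda>s. max_hamiltonian F (\<pi> \<xi>) (p s))" for \<xi>
      by (rule continuous_on_compose2[OF continuous_on_max_hamiltonian_costate[OF F, of UNIV] p]) auto
  qed
  have e: "\<pi> (x s) = x s" if "s \<in> {a..b}" for s
    unfolding \<pi>_def using M[OF that] by (intro closest_point_self) auto
  show ?thesis by (rule continuous_on_eq[OF c]) (simp add: e)
qed

lemma clarke_gradient_hamiltonian_bound:
  fixes F :: "real^'n \<Rightarrow> (real^'n) set"
  assumes F: "assumption_F F"
  obtains L where "L > 0" "\<And>x p w. x \<in> ball 0 r \<Longrightarrow>
      w \<in> clarke_gradient (\<lambda>y. max_hamiltonian F y p) x \<Longrightarrow> norm w \<le> L * norm p"
proof -
  obtain L where L: "L > 0" "\<And>x y p. x \<in> cball 0 r \<Longrightarrow> y \<in> cball 0 r \<Longrightarrow>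
      max_hamiltonian F x p - max_hamiltonian F y p \<le> L * norm p * norm (x - y)"
    using max_hamiltonian_lipschitz_state[OF F] by metis
  show thesis
  proof
    fix x p w :: "real^'n" assume x: "x \<in> ball 0 r" and w: "w \<in> clarke_gradient (\<lambda>y. max_hamiltonian F y p) x"
    show "norm w \<le> L * norm p"
      by (rule clarke_gradient_norm_le[OF open_ball x _ _ w]) (use L in auto)
  qed (rule L(1))
qed

lemma max_hamiltonian_scale:
  fixes F :: "real^'n \<Rightarrow> (real^'n) set"
  assumes F: "assumption_F F" and c: "0 \<le> c"
  shows "max_hamiltonian F x (c *\<^sub>R p) = c * max_hamiltonian F x p"
proof (rule antisym)
  obtain v where v: "v \<in> F x" "max_hamiltonian F x (c *\<^sub>R p) = v \<bullet> (c *\<^sub>R p)"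
    using max_hamiltonian_attained[OF F] by blast
  then show "max_hamiltonian F x (c *\<^sub>R p) \<le> c * max_hamiltonian F x p"
    using mult_left_mono[OF max_hamiltonian_ge[OF F v(1), of p] c] by simp
  obtain v where v: "v \<in> F x" "max_hamiltonian F x p = v \<bullet> p"
    using max_hamiltonian_attained[OF F] by blast
  then show "c * max_hamiltonian F x p \<le> max_hamiltonian F x (c *\<^sub>R p)"
    using max_hamiltonian_ge[OF F v(1), of "c *\<^sub>R p"] by simp
qed

text \<open>(H1) gives semiconvexity for unit costates only; positive homogeneity carries it to
  every nonzero \<open>p\<close> with the constant scaled by \<open>norm p\<close>.\<close>

lemma clarke_gradient_hamiltonian_le:
  fixes F :: "real^'n \<Rightarrow> (real^'n) set"
  assumes F: "assumption_F F" and H: "assumption_H F" and r: "r > 0"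
  obtains C where "C \<ge> 0" "\<And>x z p w. x \<in> ball 0 r \<Longrightarrow> z \<in> ball 0 r \<Longrightarrow> p \<noteq> 0 \<Longrightarrow>
      w \<in> clarke_gradient (\<lambda>y. max_hamiltonian F y p) x \<Longrightarrow>
      (z - x) \<bullet> w \<le> max_hamiltonian F z p - max_hamiltonian F x p + C * norm p * (norm (z - x))\<^sup>2"
proof -
  obtain C where C: "C \<ge> 0" "\<And>p. p \<in> sphere 0 1 \<Longrightarrow> semiconvex_on C (ball 0 r) (\<lambda>x. max_hamiltonian F x p)"
    using H r unfolding assumption_H_def by meson
  show thesis
  proof
    fix x z p w :: "real^'n" assume x: "x \<in> ball 0 r" and z: "z \<in> ball 0 r" and p: "p \<noteq> 0"
      and w: "w \<in> clarke_gradient (\<lambda>y. max_hamiltonian F y p) x"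
    define e where "e = (1 / norm p) *\<^sub>R p"
    have pe: "p = norm p *\<^sub>R e" using p by (simp add: e_def)
    have "e \<in> sphere 0 1" using p by (simp add: e_def)
    from C(2)[OF this] have sc: "continuous_on (ball 0 r) (\<lambda>x. max_hamiltonian F x e)"
      "\<And>x k. closed_segment (x - k) (x + k) \<subseteq> ball 0 r \<Longrightarrow>
        max_hamiltonian F (x + k) e + max_hamiltonian F (x - k) e - 2 * max_hamiltonian F x e \<ge> - C * (norm k)\<^sup>2"
      by (auto simp: semiconvex_on_def)
    have eq: "max_hamiltonian F y p = norm p * max_hamiltonian F y e" for y
      using max_hamiltonian_scale[OF F, of "norm p" y e] pe by simp
    show "(z - x) \<bullet> w \<le> max_hamiltonian F z p - max_hamiltonian F x p + C * norm p * (norm (z - x))\<^sup>2"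
    proof (rule semiconvex_clarke_le[OF open_ball convex_ball x z _ _ _ w])
      show "continuous_on (ball 0 r) (\<lambda>y. max_hamiltonian F y p)"
        unfolding eq by (intro continuous_intros sc)
      fix x k :: "real^'n" assume "closed_segment (x - k) (x + k) \<subseteq> ball 0 r"
      from mult_left_mono[OF sc(2)[OF this] norm_ge_zero[of p]]
      show "- (C * norm p) * (norm k)\<^sup>2 \<le> max_hamiltonian F (x + k) p + max_hamiltonian F (x - k) p - 2 * max_hamiltonian F x p"
        unfolding eq by (simp add: algebra_simps)
    qed (use C in auto)
  qed (rule C(1))
qed

lemma min_hamiltonian_uminus:
  fixes F :: "real^'n \<Rightarrow> (real^'n) set"
  assumes F: "assumption_F F"
  shows "min_hamiltonian F x (- p) = - max_hamiltonian F x p"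
proof -
  obtain v where v: "v \<in> F x" "min_hamiltonian F x (- p) = v \<bullet> (- p)" "\<forall>w\<in>F x. v \<bullet> (- p) \<le> w \<bullet> (- p)"
    using min_hamiltonian_attained[OF F] by metis
  obtain w where w: "w \<in> F x" "max_hamiltonian F x p = w \<bullet> p" "\<forall>v\<in>F x. v \<bullet> p \<le> w \<bullet> p"
    using max_hamiltonian_attained[OF F] by metis
  have "v \<bullet> p = w \<bullet> p"
    using bspec[OF v(3) w(1)] bspec[OF w(3) v(1)] by simp
  then show ?thesis using v(2) w(2) by simp
qed

subsection \<open>Comparison along the Hamiltonian system\<close>

text \<open>The Clarke inclusion gives \<open>|p'| \<le> L |p|\<close>, from which both the
  Lipschitz constant of \<open>p\<close> and the mutual bound with \<open>E\<close> follow; the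
  latter says that one zero of \<open>p\<close> makes all of \<open>p\<close> zero.\<close>

lemma hamiltonian_solutionE:
  fixes F :: "real^'n \<Rightarrow> (real^'n) set"
  assumes F: "assumption_F F" and sol: "hamiltonian_solution F T x p"
    and x: "continuous_on {0..T} x"
  obtains D N E where "D-lipschitz_on {0..T} p" "negligible N"
    "\<forall>s\<in>{0<..<T} - N. (x has_vector_derivative velocity F (x s) (p s)) (at s)"
    "\<forall>s\<in>{0<..<T} - N. \<exists>w. w \<in> clarke_gradient (\<lambda>y. max_hamiltonian F y (p s)) (x s) \<and>
      (p has_vector_derivative - w) (at s)"
    "\<forall>s\<in>{0..T}. \<forall>t\<in>{0..T}. (norm (p s))\<^sup>2 \<le> E * (norm (p t))\<^sup>2"
proof -
  have ac: "absolutely_continuous_on_interval 0 T p"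
    and "AE s in lebesgue_on {0..T}. \<exists>dx dp. (x has_vector_derivative dx) (at s within {0..T}) \<and>
      (p has_vector_derivative dp) (at s within {0..T}) \<and>
      GDERIV (max_hamiltonian F (x s)) (p s) :> dx \<and>
      - dp \<in> clarke_gradient (\<lambda>y. max_hamiltonian F y (p s)) (x s)"
    using sol by (auto simp: hamiltonian_solution_def)
  then obtain N where N: "negligible N"
    and ham: "\<And>s. s \<in> {0..T} - N \<Longrightarrow> \<exists>dx dp. (x has_vector_derivative dx) (at s within {0..T}) \<and>
      (p has_vector_derivative dp) (at s within {0..T}) \<and>
      GDERIV (max_hamiltonian F (x s)) (p s) :> dx \<and>
      - dp \<in> clarke_gradient (\<lambda>y. max_hamiltonian F y (p s)) (x s)"
    by (auto simp: AE_lebesgue_on_iff_negligible)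
  have der: "(x has_vector_derivative velocity F (x s) (p s)) (at s)"
    "\<exists>w. w \<in> clarke_gradient (\<lambda>y. max_hamiltonian F y (p s)) (x s) \<and> (p has_vector_derivative - w) (at s)"
    if s: "s \<in> {0<..<T} - N" for s
  proof -
    have eq: "s \<in> {0..T} - N" "at s within {0..T} = at s" using s by (auto simp: at_within_Icc_at)
    obtain dx dp where d: "(x has_vector_derivative dx) (at s)" "(p has_vector_derivative dp) (at s)"
      "GDERIV (max_hamiltonian F (x s)) (p s) :> dx"
      "- dp \<in> clarke_gradient (\<lambda>y. max_hamiltonian F y (p s)) (x s)"
      using ham[OF eq(1)] unfolding eq(2) by blast
    show "(x has_vector_derivative velocity F (x s) (p s)) (at s)"
      using d(1) GDERIV_max_hamiltonian_velocity[OF F d(3)] by simp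
    show "\<exists>w. w \<in> clarke_gradient (\<lambda>y. max_hamiltonian F y (p s)) (x s) \<and> (p has_vector_derivative - w) (at s)"
      using d(2,4) by (intro exI[of _ "- dp"]) simp
  qed
  have "bounded (x ` {0..T})" "bounded (p ` {0..T})"
    using x AC_imp_continuous_on[OF ac] by (auto intro!: compact_imp_bounded compact_continuous_image)
  then obtain M P where M: "\<And>s. s \<in> {0..T} \<Longrightarrow> norm (x s) \<le> M" and P: "\<And>s. s \<in> {0..T} \<Longrightarrow> norm (p s) \<le> P"
    by (metis bounded_iff imageI)
  \<comment> \<open>The radius exceeds \<open>M\<close> since a Clarke gradient depends on nearby
    states and needs an open ball around the arc.\<close>
  obtain L where L: "L > 0" "\<And>x p w. x \<in> ball 0 (M + 1) \<Longrightarrow>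
      w \<in> clarke_gradient (\<lambda>y. max_hamiltonian F y p) x \<Longrightarrow> norm w \<le> L * norm p"
    using clarke_gradient_hamiltonian_bound[OF F] by metis
  have dp: "\<exists>d. (p has_vector_derivative d) (at s) \<and> norm d \<le> L * norm (p s)" if s: "s \<in> {0<..<T} - N" for s
  proof -
    obtain w where w: "w \<in> clarke_gradient (\<lambda>y. max_hamiltonian F y (p s)) (x s)"
      "(p has_vector_derivative - w) (at s)" using der(2)[OF s] by blast
    have "x s \<in> ball 0 (M + 1)" using M[of s] s by simp
    from L(2)[OF this w(1)] w(2) show ?thesis by (intro exI[of _ "- w"]) simp
  qed
  have lip: "(L * \<bar>P\<bar>)-lipschitz_on {0..T} p"
  proof (rule AC_bounded_derivative_imp_lipschitz[OF ac N])
    fix s assume s: "s \<in> {0<..<T} - N"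
    have "L * norm (p s) \<le> L * \<bar>P\<bar>" using P[of s] s L(1) by (intro mult_left_mono) auto
    with dp[OF s] show "\<exists>d. (p has_vector_derivative d) (at s) \<and> norm d \<le> L * \<bar>P\<bar>"
      by (meson order_trans)
  qed (use L(1) in auto)
  show thesis
  proof (rule that[OF lip N])
    show "\<forall>s\<in>{0..T}. \<forall>t\<in>{0..T}. (norm (p s))\<^sup>2 \<le> exp (2 * L * (T - 0)) * (norm (p t))\<^sup>2"
      using gronwall_two_sided[OF lip N _ dp] L(1) by simp
  qed (use der in auto)
qed

lemma velocity_bound:
  fixes F :: "real^'n \<Rightarrow> (real^'n) set"
  assumes F: "assumption_F F"
  obtains B where "B > 0" "\<And>x p. x \<in> cball 0 r \<Longrightarrow> norm (velocity F x p) \<le> B"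
proof -
  have "\<exists>\<gamma>>0. \<forall>x. \<forall>v\<in>F x. norm v \<le> \<gamma> * (1 + norm x)"
    using F by (simp add: assumption_F_def)
  then obtain \<gamma> where \<gamma>: "\<gamma> > 0" "\<And>v x. v \<in> F x \<Longrightarrow> norm v \<le> \<gamma> * (1 + norm x)"
    by auto
  show thesis
  proof
    show "\<gamma> * (1 + \<bar>r\<bar>) > 0" using \<gamma>(1) by (intro mult_pos_pos) auto
    fix x p :: "real^'n" assume x: "x \<in> cball 0 r"
    have "norm (velocity F x p) \<le> \<gamma> * (1 + norm x)" by (rule \<gamma>(2)[OF velocity(1)[OF F]])
    also have "\<dots> \<le> \<gamma> * (1 + \<bar>r\<bar>)" using x \<gamma>(1) by (intro mult_left_mono) auto
    finally show "norm (velocity F x p) \<le> \<gamma> * (1 + \<bar>r\<bar>)" .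
  qed
qed

text \<open>Truncating the state by the projection \<open>\<pi>\<close> onto a large ball makes the closed-loop field
  \<open>velocity F (\<pi> \<xi>) (p s)\<close> globally Lipschitz; it is solved backwards from time \<open>t\<close>.\<close>

lemma backward_closed_loop:
  fixes F :: "real^'n \<Rightarrow> (real^'n) set"
  assumes F: "assumption_F F" and H: "assumption_H F" and t: "0 \<le> t"
    and p: "continuous_on {0..t} p" "\<And>s. s \<in> {0..t} \<Longrightarrow> p s \<noteq> 0" and r: "r \<ge> 0"
  obtains B where "\<And>y. \<exists>z. z t = y \<and> B-lipschitz_on {0..t} z \<and>
    (\<forall>s\<in>{0<..<t}. (z has_vector_derivative velocity F (closest_point (cball 0 r) (z s)) (p s)) (at s))"
proof -
  define \<pi> where "\<pi> = closest_point (cball (0::real^'n) r)"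
  have \<pi>: "\<pi> \<xi> \<in> cball 0 r" for \<xi> unfolding \<pi>_def using r by (intro closest_point_in_set) auto
  then have \<pi>b: "\<pi> \<xi> \<in> ball 0 (r + 1)" for \<xi> by (smt (verit) mem_ball mem_cball)
  have \<pi>l: "norm (\<pi> \<xi> - \<pi> \<eta>) \<le> norm (\<xi> - \<eta>)" for \<xi> \<eta>
    unfolding \<pi>_def dist_norm[symmetric] using r by (intro closest_point_lipschitz) auto
  obtain L where L: "L > 0" "\<And>p x y. p \<noteq> 0 \<Longrightarrow> x \<in> ball 0 (r + 1) \<Longrightarrow> y \<in> ball 0 (r + 1) \<Longrightarrow>
    norm (velocity F x p - velocity F y p) \<le> L * norm (x - y)"
    using velocity_lipschitz[OF F H, of "r + 1"] r by (metis add_nonneg_pos zero_less_one)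
  obtain B where B: "B > 0" "\<And>x p. x \<in> cball 0 r \<Longrightarrow> norm (velocity F x p) \<le> B"
    using velocity_bound[OF F] by metis
  \<comment> \<open>The solver runs forward from time zero, so time is reversed by
    \<open>\<tau> = t - s\<close> and the field changes sign.\<close>
  define g where "g = (\<lambda>\<tau> \<xi>. - velocity F (\<pi> \<xi>) (p (t - \<tau>)))"
  have glip: "norm (g \<tau> \<xi> - g \<tau> \<eta>) \<le> L * norm (\<xi> - \<eta>)" if "\<tau> \<in> {0..t}" for \<tau> \<xi> \<eta>
  proof -
    have "p (t - \<tau>) \<noteq> 0" using p(2) that by auto
    then have "norm (g \<tau> \<xi> - g \<tau> \<eta>) \<le> L * norm (\<pi> \<xi> - \<pi> \<eta>)"
      using L(2)[OF _ \<pi>b[of \<xi>] \<pi>b[of \<eta>]] by (simp add: g_def norm_minus_commute)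
    also have "\<dots> \<le> L * norm (\<xi> - \<eta>)" using \<pi>l L(1) by (intro mult_left_mono) auto
    finally show ?thesis .
  qed
  have pt: "continuous_on {0..t} (\<lambda>\<tau>. p (t - \<tau>))"
    by (rule continuous_on_compose2[OF p(1)]) (auto intro!: continuous_intros)
  have gcont: "continuous_on {0..t} (\<lambda>\<tau>. g \<tau> \<xi>)" for \<xi>
    unfolding g_def using p(2)
    by (intro continuous_intros continuous_on_compose2[OF continuous_on_velocity_costate[OF F H] pt]) auto
  show thesis
  proof (rule that)
    fix y :: "real^'n"
    obtain u where u: "u 0 = y"
      and ud: "\<And>s. s \<in> {0..t} \<Longrightarrow> (u has_vector_derivative g s (u s)) (at s within {0..t})"
      using ode_global_solution[OF t L(1) glip gcont, of y] by blast
    have ul: "B-lipschitz_on {0..t} u"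
    proof (rule bounded_derivative_imp_lipschitz)
      fix s assume s: "s \<in> {0..t}"
      show "(u has_derivative (\<lambda>h. h *\<^sub>R g s (u s))) (at s within {0..t})"
        using ud[OF s] by (simp add: has_vector_derivative_def)
      have "norm (g s (u s)) \<le> B" unfolding g_def using B(2)[OF \<pi>] by simp
      then have "norm (h *\<^sub>R g s (u s)) \<le> B * norm h" for h
        using mult_left_mono[of "norm (g s (u s))" B "\<bar>h\<bar>"] by (simp add: mult.commute)
      then show "onorm (\<lambda>h. h *\<^sub>R g s (u s)) \<le> B"
        by (rule onorm_bound[rotated]) (use B(1) in simp)
    qed (use B(1) in auto)
    define z where "z = (\<lambda>s. u (t - s))"
    have "B-lipschitz_on {0..t} z"
    proof (rule lipschitz_onI)
      fix r s assume "r \<in> {0..t}" "s \<in> {0..t}"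
      then have "dist (z r) (z s) \<le> B * dist (t - r) (t - s)"
        unfolding z_def by (intro lipschitz_onD[OF ul]) auto
      then show "dist (z r) (z s) \<le> B * dist r s" by (simp add: dist_real_def abs_minus_commute)
    qed (use B(1) in simp)
    moreover have "(z has_vector_derivative velocity F (\<pi> (z s)) (p s)) (at s)" if s: "s \<in> {0<..<t}" for s
    proof -
      have "(u has_vector_derivative g (t - s) (u (t - s))) (at (t - s))"
        using ud[of "t - s"] s by (auto simp: at_within_Icc_at)
      moreover have "((\<lambda>s. t - s) has_vector_derivative - 1) (at s)"
        by (auto intro!: derivative_eq_intros)
      ultimately have "((u \<circ> (\<lambda>s. t - s)) has_vector_derivative (- 1) *\<^sub>R g (t - s) (u (t - s))) (at s)"
        by (intro vector_diff_chain_at)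
      then show ?thesis by (simp add: o_def z_def g_def)
    qed
    moreover have "z t = y" using u by (simp add: z_def)
    ultimately show "\<exists>z. z t = y \<and> B-lipschitz_on {0..t} z \<and>
      (\<forall>s\<in>{0<..<t}. (z has_vector_derivative velocity F (closest_point (cball 0 r) (z s)) (p s)) (at s))"
      unfolding \<pi>_def by blast
  qed
qed

text \<open>Along the comparison arc \<open>z\<close> the derivative of \<open>- p \<bullet> (z - x)\<close> equals
  \<open>w \<bullet> (z - x) - (H(z, p) - H(x, p))\<close> with \<open>w \<in> \<partial>\<^sub>x H(x, p)\<close>, which semiconvexity bounds by
  a multiple of \<open>|z - x|\<^sup>2\<close>.\<close>

lemma backward_comparison:
  fixes F :: "real^'n \<Rightarrow> (real^'n) set"
  assumes F: "assumption_F F" and H: "assumption_H F" and t: "0 \<le> t"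
    and x: "C-lipschitz_on {0..t} x" and p: "D-lipschitz_on {0..t} p"
    and p0: "\<And>s. s \<in> {0..t} \<Longrightarrow> p s \<noteq> 0" and N: "negligible N"
    and dx: "\<forall>s\<in>{0<..<t} - N. (x has_vector_derivative velocity F (x s) (p s)) (at s)"
    and dp: "\<forall>s\<in>{0<..<t} - N. \<exists>w. w \<in> clarke_gradient (\<lambda>y. max_hamiltonian F y (p s)) (x s) \<and>
      (p has_vector_derivative - w) (at s)"
  obtains \<delta> A where "\<delta> > 0" "A \<ge> 0" "\<forall>y. norm (y - x t) \<le> \<delta> \<longrightarrow>
    (\<exists>z. trajectory F t (z 0) z \<and> z t = y \<and> (norm (z 0 - x 0))\<^sup>2 \<le> A * (norm (y - x t))\<^sup>2 \<and>
      (- p t) \<bullet> (y - x t) \<le> (- p 0) \<bullet> (z 0 - x 0) + A * (norm (y - x t))\<^sup>2)"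
proof -
  have "bounded (x ` {0..t})" "bounded (p ` {0..t})"
    using x p by (auto intro!: compact_imp_bounded compact_continuous_image lipschitz_on_continuous_on)
  then obtain M' P' where M': "\<And>s. s \<in> {0..t} \<Longrightarrow> norm (x s) \<le> M'" and P': "\<And>s. s \<in> {0..t} \<Longrightarrow> norm (p s) \<le> P'"
    by (metis bounded_iff imageI)
  define M P where "M = \<bar>M'\<bar>" and "P = \<bar>P'\<bar>"
  have M: "\<And>s. s \<in> {0..t} \<Longrightarrow> norm (x s) \<le> M" and P: "\<And>s. s \<in> {0..t} \<Longrightarrow> norm (p s) \<le> P"
    and MP: "M \<ge> 0" "P \<ge> 0"
    using M' P' by (fastforce simp: M_def P_def)+
  \<comment> \<open>One unit of room around the arc: states within distance 1 of \<open>x\<close>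
    are not truncated.\<close>
  define \<pi> where "\<pi> = closest_point (cball (0::real^'n) (M + 1))"
  have \<pi>: "\<pi> \<xi> \<in> cball 0 (M + 1)" for \<xi> unfolding \<pi>_def using MP by (intro closest_point_in_set) auto
  have \<pi>l: "norm (\<pi> \<xi> - \<pi> \<eta>) \<le> norm (\<xi> - \<eta>)" for \<xi> \<eta>
    unfolding \<pi>_def dist_norm[symmetric] using MP by (intro closest_point_lipschitz) auto
  have \<pi>id: "\<pi> \<xi> = \<xi>" if "norm \<xi> \<le> M + 1" for \<xi>
    unfolding \<pi>_def using that by (intro closest_point_self) auto
  obtain B where B: "\<And>y. \<exists>z. z t = y \<and> B-lipschitz_on {0..t} z \<and>
    (\<forall>s\<in>{0<..<t}. (z has_vector_derivative velocity F (\<pi> (z s)) (p s)) (at s))"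
    using backward_closed_loop[OF F H t lipschitz_on_continuous_on[OF p] p0, of "M + 1"] MP
    unfolding \<pi>_def by (metis add_nonneg_nonneg zero_le_one)
  have R: "M + 2 > 0" using MP by simp
  obtain L where L: "L > 0" "\<And>p x y. p \<noteq> 0 \<Longrightarrow> x \<in> ball 0 (M + 2) \<Longrightarrow> y \<in> ball 0 (M + 2) \<Longrightarrow>
    norm (velocity F x p - velocity F y p) \<le> L * norm (x - y)"
    using velocity_lipschitz[OF F H R] by metis
  obtain K where K: "K \<ge> 0" "\<And>x z p w. x \<in> ball 0 (M + 2) \<Longrightarrow> z \<in> ball 0 (M + 2) \<Longrightarrow> p \<noteq> 0 \<Longrightarrow>
      w \<in> clarke_gradient (\<lambda>y. max_hamiltonian F y p) x \<Longrightarrow>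
      (z - x) \<bullet> w \<le> max_hamiltonian F z p - max_hamiltonian F x p + K * norm p * (norm (z - x))\<^sup>2"
    using clarke_gradient_hamiltonian_le[OF F H R] by metis
  define E where "E = exp (2 * L * t)"
  have E: "E \<ge> 1" using L(1) t by (simp add: E_def)
  \<comment> \<open>\<open>E\<close> is the Gronwall factor for the squared distance; the other
    summand is the semiconvexity error rate integrated over a time span of length
    \<open>t\<close>.\<close>
  define A where "A = E + K * P * E * t"
  have KPE: "K * P * E * t \<ge> 0" using K(1) MP E t by simp
  show thesis
  proof (rule that; (intro allI impI)?)
    \<comment> \<open>This \<open>\<delta>\<close> satisfies \<open>E * \<delta>^2 = 1\<close>, so
      Gronwall keeps \<open>z\<close> within distance 1 of \<open>x\<close>.\<close>
    show "exp (- (L * t)) > 0" by simp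
    show "A \<ge> 0" using E KPE by (simp add: A_def)
    fix y assume y: "norm (y - x t) \<le> exp (- (L * t))"
    define e where "e = (norm (y - x t))\<^sup>2"
    have "E * e \<le> E * (exp (- (L * t)))\<^sup>2"
      unfolding e_def using y E by (intro mult_left_mono power_mono) auto
    also have "\<dots> = 1" by (simp add: E_def power2_eq_square flip: exp_add)
    finally have Ee: "E * e \<le> 1" .
    obtain z where z: "z t = y" and zl: "B-lipschitz_on {0..t} z"
      and dz: "\<And>s. s \<in> {0<..<t} \<Longrightarrow> (z has_vector_derivative velocity F (\<pi> (z s)) (p s)) (at s)"
      using B[of y] by blast
    define q where "q = (\<lambda>s. z s - x s)"
    have ql: "(B + C)-lipschitz_on {0..t} q"
      unfolding q_def by (intro lipschitz_on_diff zl x)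
    have dq: "(q has_vector_derivative velocity F (\<pi> (z s)) (p s) - velocity F (x s) (p s)) (at s)"
      if "s \<in> {0<..<t} - N" for s
      unfolding q_def using dz dx that by (intro has_vector_derivative_diff) auto
    \<comment> \<open>The estimate is made for the truncated field, where nonexpansiveness of
      \<open>\<pi>\<close> suffices; only afterwards does it show that the truncation was inactive.
      This avoids a circular argument.\<close>
    have qe: "(norm (q s))\<^sup>2 \<le> E * e" if s: "s \<in> {0..t}" for s
    proof -
      have "(norm (q s))\<^sup>2 \<le> exp (2 * L * (t - 0)) * (norm (q t))\<^sup>2"
      proof (rule gronwall_two_sided[OF ql N _ _ s])
        fix s assume s: "s \<in> {0<..<t} - N"
        have "x s = \<pi> (x s)" using \<pi>id M[of s] s by simp
        moreover have "\<pi> (z s) \<in> ball 0 (M + 2)" "\<pi> (x s) \<in> ball 0 (M + 2)"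
          using \<pi>[of "z s"] \<pi>[of "x s"] by auto
        ultimately have "norm (velocity F (\<pi> (z s)) (p s) - velocity F (x s) (p s)) \<le> L * norm (\<pi> (z s) - \<pi> (x s))"
          using L(2)[of "p s" "\<pi> (z s)" "\<pi> (x s)"] p0[of s] s by simp
        also have "\<dots> \<le> L * norm (q s)"
          unfolding q_def using \<pi>l L(1) by (intro mult_left_mono) auto
        finally show "\<exists>d. (q has_vector_derivative d) (at s) \<and> norm d \<le> L * norm (q s)"
          using dq[OF s] by blast
      qed (use L t in auto)
      then show ?thesis by (simp add: E_def e_def q_def z)
    qed
    have zM: "norm (z s) \<le> M + 1" if s: "s \<in> {0..t}" for s
    proof -
      have "(norm (q s))\<^sup>2 \<le> 1\<^sup>2" using qe[OF s] Ee by simp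
      then have "norm (q s) \<le> 1" by (rule power2_le_imp_le) simp
      then show ?thesis using M[OF s] norm_triangle_ineq[of "q s" "x s"] by (simp add: q_def)
    qed
    have zt: "trajectory F t (z 0) z"
    proof (rule trajectoryI[OF zl refl negligible_empty])
      fix s assume s: "s \<in> {0<..<t} - {}"
      then have "(z has_vector_derivative velocity F (z s) (p s)) (at s)"
        using dz[of s] \<pi>id[OF zM[of s]] by auto
      then show "\<exists>v\<in>F (z s). (z has_vector_derivative v) (at s)" using velocity(1)[OF F] by blast
    qed
    obtain G where G: "G-lipschitz_on {0..t} (\<lambda>s. p s \<bullet> q s)"
      using lipschitz_on_inner_Icc[OF p ql] .
    then have "G-lipschitz_on {0..t} (\<lambda>s. - (p s \<bullet> q s))" by simp
    then have "- (p t \<bullet> q t) - - (p 0 \<bullet> q 0) \<le> K * P * (E * e) * (t - 0)"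
    proof (rule AC_increment_le_within[OF lipschitz_imp_AC N])
      fix s assume s: "s \<in> {0<..<t} - N"
      then have s': "s \<in> {0..t}" by auto
      obtain w where w: "w \<in> clarke_gradient (\<lambda>y. max_hamiltonian F y (p s)) (x s)"
        "(p has_vector_derivative - w) (at s)" using dp s by blast
      let ?dq = "velocity F (\<pi> (z s)) (p s) - velocity F (x s) (p s)"
      have "((\<lambda>s. p s \<bullet> q s) has_vector_derivative p s \<bullet> ?dq + (- w) \<bullet> q s) (at s)"
        using bounded_bilinear.has_vector_derivative[OF bounded_bilinear_inner w(2) dq[OF s]] .
      then have der: "((\<lambda>s. - (p s \<bullet> q s)) has_vector_derivative - (p s \<bullet> ?dq + (- w) \<bullet> q s)) (at s)"
        by (rule has_vector_derivative_minus)
      have "p s \<bullet> ?dq = max_hamiltonian F (z s) (p s) - max_hamiltonian F (x s) (p s)"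
        using velocity(2)[OF F] \<pi>id[OF zM[OF s']] by (simp add: inner_diff_right inner_commute)
      moreover have "x s \<in> ball 0 (M + 2)" "z s \<in> ball 0 (M + 2)" using M[OF s'] zM[OF s'] by auto
      with K(2)[OF this p0[OF s'] w(1)]
      have "q s \<bullet> w \<le> max_hamiltonian F (z s) (p s) - max_hamiltonian F (x s) (p s) + K * norm (p s) * (norm (q s))\<^sup>2"
        by (simp add: q_def)
      moreover have "K * norm (p s) * (norm (q s))\<^sup>2 \<le> K * P * (E * e)"
        using K(1) P[OF s'] qe[OF s'] MP by (intro mult_mono) auto
      ultimately have "- (p s \<bullet> ?dq + (- w) \<bullet> q s) \<le> K * P * (E * e)" by (simp add: inner_commute)
      with der show "\<exists>d\<le>K * P * (E * e). ((\<lambda>s. - (p s \<bullet> q s)) has_vector_derivative d) (at s)" by blast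
    qed (use t in auto)
    then have "(- p t) \<bullet> (y - x t) \<le> (- p 0) \<bullet> (z 0 - x 0) + K * P * E * t * e"
      by (simp add: q_def z mult_ac)
    also have "K * P * E * t * e \<le> A * e"
      unfolding A_def e_def using E by (intro mult_right_mono) auto
    finally have fin: "(- p t) \<bullet> (y - x t) \<le> (- p 0) \<bullet> (z 0 - x 0) + A * e" by simp
    have "(norm (z 0 - x 0))\<^sup>2 \<le> E * e" using qe[of 0] t by (simp add: q_def)
    also have "\<dots> \<le> A * e" unfolding A_def e_def using KPE by (intro mult_right_mono) auto
    finally show "\<exists>z. trajectory F t (z 0) z \<and> z t = y \<and> (norm (z 0 - x 0))\<^sup>2 \<le> A * (norm (y - x t))\<^sup>2 \<and>
      (- p t) \<bullet> (y - x t) \<le> (- p 0) \<bullet> (z 0 - x 0) + A * (norm (y - x t))\<^sup>2"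
      using zt z fin unfolding e_def by blast
  qed
qed

subsection \<open>Propagation of the horizontal subdifferential\<close>

lemma mem_horizontal_proximal_subdifferential_iff:
  assumes "f x = ereal c"
  shows "v \<in> horizontal_proximal_subdifferential f x \<longleftrightarrow>
    (\<exists>\<sigma>\<ge>0. \<forall>y \<beta>. f y < \<infinity> \<and> f y \<le> ereal \<beta> \<longrightarrow>
      v \<bullet> (y - x) \<le> \<sigma> * ((norm (y - x))\<^sup>2 + (\<beta> - c)\<^sup>2))"
  using assms
  by (auto simp: horizontal_proximal_subdifferential_def proximal_normal_cone_def epi_def norm_Pair)

text \<open>If \<open>(y, \<beta>)\<close> lies in the epigraph, so does
  \<open>(z 0, t + \<beta>)\<close>, and its height offset \<open>t + \<beta> - T\<close> equals
  \<open>\<beta> - (T - t)\<close>. The inequality at \<open>x0\<close> therefore transfers with no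
  error in the height.\<close>

lemma horizontal_subdifferential_propagates:
  fixes F :: "real^'n \<Rightarrow> (real^'n) set"
  assumes F: "assumption_F F"
    and x0: "min_time F K x0 = ereal T" and xt: "min_time F K xt = ereal (T - t)" and t: "0 \<le> t"
    and p0: "- p0 \<in> horizontal_proximal_subdifferential (min_time F K) x0"
    and \<delta>: "\<delta> > 0" and A: "A \<ge> 0"
    and cmp: "\<forall>y. norm (y - xt) \<le> \<delta> \<longrightarrow>
      (\<exists>z. trajectory F t (z 0) z \<and> z t = y \<and> (norm (z 0 - x0))\<^sup>2 \<le> A * (norm (y - xt))\<^sup>2 \<and>
        (- pt) \<bullet> (y - xt) \<le> (- p0) \<bullet> (z 0 - x0) + A * (norm (y - xt))\<^sup>2)"
  shows "- pt \<in> horizontal_proximal_subdifferential (min_time F K) xt"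
proof -
  obtain \<sigma> where \<sigma>: "\<sigma> \<ge> 0" "\<And>y \<beta>. min_time F K y < \<infinity> \<Longrightarrow> min_time F K y \<le> ereal \<beta> \<Longrightarrow>
      (- p0) \<bullet> (y - x0) \<le> \<sigma> * ((norm (y - x0))\<^sup>2 + (\<beta> - T)\<^sup>2)"
    using p0 unfolding mem_horizontal_proximal_subdifferential_iff[of "min_time F K" x0 T, OF x0] by blast
  \<comment> \<open>The terms serve, in turn, the displacement of \<open>z 0\<close>, the comparison
    error, the heights, and the \<open>y\<close> farther than \<open>\<delta>\<close>, where
    \<open>|y - xt| \<le> |y - xt|^2 / \<delta>\<close>.\<close>
  define S where "S = \<sigma> * A + A + \<sigma> + norm pt / \<delta>"
  have S: "S \<ge> \<sigma> * A + A" "S \<ge> \<sigma>" "S \<ge> norm pt / \<delta>" "S \<ge> 0"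
    using \<sigma>(1) A \<delta> by (auto simp: S_def)
  have "(- pt) \<bullet> (y - xt) \<le> S * ((norm (y - xt))\<^sup>2 + (\<beta> - (T - t))\<^sup>2)"
    if y: "min_time F K y < \<infinity>" "min_time F K y \<le> ereal \<beta>" for y \<beta>
  proof (cases "norm (y - xt) \<le> \<delta>")
    case True
    let ?e = "(norm (y - xt))\<^sup>2" and ?b = "(\<beta> - (T - t))\<^sup>2"
    obtain z where z: "trajectory F t (z 0) z" "z t = y" "(norm (z 0 - x0))\<^sup>2 \<le> A * ?e"
      "(- pt) \<bullet> (y - xt) \<le> (- p0) \<bullet> (z 0 - x0) + A * ?e"
      using cmp True by blast
    have "min_time F K (z 0) \<le> ereal t + min_time F K y"
      using min_time_le_trajectory[OF F t z(1)] z(2) by simp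
    also have "\<dots> \<le> ereal t + ereal \<beta>" using y(2) by (rule add_left_mono)
    finally have le: "min_time F K (z 0) \<le> ereal (t + \<beta>)" by simp
    then have "min_time F K (z 0) < \<infinity>" by (rule le_less_trans) simp
    from \<sigma>(2)[OF this le] have "(- p0) \<bullet> (z 0 - x0) \<le> \<sigma> * ((norm (z 0 - x0))\<^sup>2 + ?b)"
      by (simp add: algebra_simps)
    also have "\<dots> \<le> \<sigma> * (A * ?e + ?b)" using z(3) \<sigma>(1) by (intro mult_left_mono) auto
    finally have "(- pt) \<bullet> (y - xt) \<le> (\<sigma> * A + A) * ?e + \<sigma> * ?b"
      using z(4) by (simp add: algebra_simps)
    also have "\<dots> \<le> S * ?e + S * ?b" using S by (intro add_mono mult_right_mono) auto
    finally show ?thesis by (simp add: algebra_simps)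
  next
    case False
    have "(- pt) \<bullet> (y - xt) \<le> norm pt * norm (y - xt)"
      using norm_cauchy_schwarz[of "- pt" "y - xt"] by simp
    also have "\<dots> \<le> norm pt * ((norm (y - xt))\<^sup>2 / \<delta>)"
    proof (rule mult_left_mono)
      have "norm (y - xt) * \<delta> \<le> norm (y - xt) * norm (y - xt)"
        using False by (intro mult_left_mono) auto
      then show "norm (y - xt) \<le> (norm (y - xt))\<^sup>2 / \<delta>"
        using \<delta> by (simp add: pos_le_divide_eq power2_eq_square)
    qed simp
    also have "\<dots> = norm pt / \<delta> * (norm (y - xt))\<^sup>2" by simp
    also have "\<dots> \<le> S * ((norm (y - xt))\<^sup>2 + (\<beta> - (T - t))\<^sup>2)"
      using S by (intro mult_mono) auto
    finally show ?thesis .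
  qed
  then show ?thesis
    unfolding mem_horizontal_proximal_subdifferential_iff[of "min_time F K" xt "T - t", OF xt]
    using S(4) by blast
qed

text \<open>The points \<open>(x r, T - r)\<close> all lie in the epigraph, so the proximal inequality tested on them
  says that \<open>r \<mapsto> - p \<bullet> x r - k (r - s)\<^sup>2\<close> is maximal at \<open>s\<close>.\<close>

lemma horizontal_subdifferential_velocity_orthogonal:
  fixes x :: "real \<Rightarrow> 'a::real_inner"
  assumes x: "C-lipschitz_on {0..T} x" and s: "s \<in> {0<..<T}"
    and V: "\<And>r. r \<in> {0..T} \<Longrightarrow> V (x r) = ereal (T - r)"
    and p: "- p \<in> horizontal_proximal_subdifferential V (x s)"
    and d: "(x has_vector_derivative v) (at s)"
  shows "v \<bullet> p = 0"
proof -
  have "V (x s) = ereal (T - s)" using V s by simp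
  with p obtain \<sigma> where \<sigma>: "\<sigma> \<ge> 0" "\<And>y \<beta>. V y < \<infinity> \<Longrightarrow> V y \<le> ereal \<beta> \<Longrightarrow>
      (- p) \<bullet> (y - x s) \<le> \<sigma> * ((norm (y - x s))\<^sup>2 + (\<beta> - (T - s))\<^sup>2)"
    unfolding mem_horizontal_proximal_subdifferential_iff[of V "x s" "T - s", OF \<open>V (x s) = _\<close>] by blast
  \<comment> \<open>\<open>C^2\<close> comes from the displacement of \<open>x\<close>, the 1 from
    the heights. The penalty \<open>k (r - s)^2\<close> has zero derivative at \<open>s\<close>, so
    it leaves the first-order condition untouched.\<close>
  define k where "k = \<sigma> * (C\<^sup>2 + 1)"
  define \<psi> where "\<psi> = (\<lambda>r. - (x r \<bullet> p) - k * (r - s)\<^sup>2)"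
  have "((\<lambda>r. x r \<bullet> p) has_vector_derivative v \<bullet> p) (at s)"
    using bounded_linear.has_vector_derivative[OF bounded_linear_inner_left d] .
  then have "((\<lambda>r. x r \<bullet> p) has_real_derivative v \<bullet> p) (at s)"
    by (simp add: has_real_derivative_iff_has_vector_derivative)
  then have "(\<psi> has_real_derivative - (v \<bullet> p)) (at s)"
    unfolding \<psi>_def by (auto intro!: derivative_eq_intros)
  \<comment> \<open>The radius keeps \<open>r\<close> inside the interval on both sides of
    \<open>s\<close>; a one-sided maximum would give only an inequality.\<close>
  moreover have "\<psi> r \<le> \<psi> s" if r: "\<bar>s - r\<bar> < min s (T - s)" for r
  proof -
    have r': "r \<in> {0..T}" "s \<in> {0..T}" using r s by auto
    have "norm (x r - x s) \<le> C * \<bar>r - s\<bar>" using lipschitz_on_normD[OF x r'] by simp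
    then have "(norm (x r - x s))\<^sup>2 \<le> (C * \<bar>r - s\<bar>)\<^sup>2" by (intro power_mono) auto
    then have "(norm (x r - x s))\<^sup>2 \<le> C\<^sup>2 * (r - s)\<^sup>2" by (simp add: power_mult_distrib)
    moreover have "((T - r) - (T - s))\<^sup>2 = (r - s)\<^sup>2" by (simp add: power2_commute)
    ultimately have "(norm (x r - x s))\<^sup>2 + ((T - r) - (T - s))\<^sup>2 \<le> (C\<^sup>2 + 1) * (r - s)\<^sup>2"
      by (simp add: algebra_simps)
    then have "\<sigma> * ((norm (x r - x s))\<^sup>2 + ((T - r) - (T - s))\<^sup>2) \<le> k * (r - s)\<^sup>2"
      using \<sigma>(1) unfolding k_def mult.assoc by (intro mult_left_mono)
    moreover have "(- p) \<bullet> (x r - x s) \<le> \<sigma> * ((norm (x r - x s))\<^sup>2 + ((T - r) - (T - s))\<^sup>2)"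
      using \<sigma>(2)[of "x r" "T - r"] V[OF r'(1)] by simp
    ultimately show ?thesis by (simp add: \<psi>_def inner_diff_right inner_commute)
  qed
  moreover have "0 < min s (T - s)" using s by auto
  ultimately have "- (v \<bullet> p) = 0" using DERIV_local_max[of \<psi> _ s "min s (T - s)"] by blast
  then show ?thesis by simp
qed

text \<open>A nonempty open set is never negligible, so the complement of \<open>N\<close> is dense
  in the interval.\<close>

lemma continuous_zero_off_negligible:
  fixes h :: "real \<Rightarrow> real"
  assumes h: "continuous_on {a..b} h" and ab: "a < b" and N: "negligible N"
    and z: "\<And>s. s \<in> {a<..<b} - N \<Longrightarrow> h s = 0" and t: "t \<in> {a..b}"
  shows "h t = 0"
proof -
  let ?S = "{a<..<b} - N"
  have "{a<..<b} \<subseteq> closure ?S"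
  proof (rule ccontr)
    assume "\<not> {a<..<b} \<subseteq> closure ?S"
    then have "{a<..<b} - closure ?S \<noteq> {}" by blast
    moreover have "open ({a<..<b} - closure ?S)" by (intro open_Diff) auto
    moreover have "{a<..<b} - closure ?S \<subseteq> N" using closure_subset[of ?S] by blast
    ultimately show False using open_not_negligible negligible_subset[OF N] by blast
  qed
  then have "closure {a<..<b} \<subseteq> closure ?S" by (rule closure_minimal) simp
  then have "{a..b} \<subseteq> closure ?S" using ab by simp
  moreover have "closure ?S \<subseteq> {a..b}" by (rule closure_minimal) auto
  ultimately have "closure ?S = {a..b}" by simp
  then show ?thesis using continuous_constant_on_closure[of ?S h 0 t] h z t by simp
qed

theorem corollary4p8:
  fixes F :: "real^'n \<Rightarrow> (real^'n) set"
    and K :: "(real^'n) set"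
    and x0 :: "real^'n"
    and x p :: "real \<Rightarrow> real^'n"
  assumes "assumption_F F"
    and "assumption_H F"
    and "closed K"
    and "x0 \<in> controllable_set F K - K"
    and "optimal_trajectory F K x0 x"
    and "hamiltonian_solution F (real_of_ereal (min_time F K x0)) x p"
    and "x 0 = x0"
    and "- p 0 \<in> horizontal_proximal_subdifferential (min_time F K) x0"
  shows "\<forall>t\<in>{0..real_of_ereal (min_time F K x0)}.
           - p t \<in> horizontal_proximal_subdifferential (min_time F K) (x t) \<and>
           min_hamiltonian F (x t) (- p t) = 0"
proof -
  note F = assms(1) and H = assms(2)
  define T where "T = real_of_ereal (min_time F K x0)"
  have fin: "min_time F K x0 < \<infinity>" using assms(4) by (simp add: controllable_set_def)
  have x0T: "min_time F K x0 = ereal T" and T0: "0 \<le> T"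
    unfolding T_def using fin min_time_nonneg[of F K x0] by (cases "min_time F K x0"; simp)+
  have traj: "trajectory F T x0 x" and xT: "x T \<in> K"
    using assms(5) by (auto simp: optimal_trajectory_def T_def)
  \<comment> \<open>The start lies outside the target and the end inside. Positivity of
    \<open>T\<close> lets the endpoint values be recovered as limits from the open interval.\<close>
  have "T \<noteq> 0" using xT assms(4,7) by auto
  with T0 have T: "0 < T" by simp
  have V: "min_time F K (x t) = ereal (T - t)" if "t \<in> {0..T}" for t
    using min_time_along_optimal[OF F traj xT x0T that] .
  obtain C M where x: "C-lipschitz_on {0..T} x" using trajectoryE[OF F traj] by metis
  have xc: "continuous_on {0..T} x" using x by (rule lipschitz_on_continuous_on)
  obtain D N E where p: "D-lipschitz_on {0..T} p" and N: "negligible N"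
    and dx: "\<forall>s\<in>{0<..<T} - N. (x has_vector_derivative velocity F (x s) (p s)) (at s)"
    and dp: "\<forall>s\<in>{0<..<T} - N. \<exists>w. w \<in> clarke_gradient (\<lambda>y. max_hamiltonian F y (p s)) (x s) \<and>
      (p has_vector_derivative - w) (at s)"
    and E: "\<forall>s\<in>{0..T}. \<forall>t\<in>{0..T}. (norm (p s))\<^sup>2 \<le> E * (norm (p t))\<^sup>2"
    using hamiltonian_solutionE[OF F _ xc, of p] assms(6) unfolding T_def[symmetric] by blast
  have sub: "- p t \<in> horizontal_proximal_subdifferential (min_time F K) (x t)" if t: "t \<in> {0..T}" for t
  proof (cases "p 0 = 0")
    case True
    \<comment> \<open>Here \<open>p\<close> is identically zero, and the zero vector satisfies the
      proximal inequality trivially, so no comparison arc is built.\<close>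
    then have "(norm (p t))\<^sup>2 \<le> 0" using E t T by force
    then have "p t = 0" by simp
    then show ?thesis
      unfolding mem_horizontal_proximal_subdifferential_iff[of "min_time F K" "x t" "T - t", OF V[OF t]]
      by auto
  next
    case False
    have p0: "p s \<noteq> 0" if "s \<in> {0..T}" for s
    proof
      assume "p s = 0"
      then have "(norm (p 0))\<^sup>2 \<le> 0" using E that T by force
      with False show False by simp
    qed
    have tT: "0 \<le> t" "t \<le> T" using t by auto
    have x': "C-lipschitz_on {0..t} x" and p': "D-lipschitz_on {0..t} p"
      using x p tT by (auto intro: lipschitz_on_subset)
    have p0': "\<And>s. s \<in> {0..t} \<Longrightarrow> p s \<noteq> 0" using p0 tT by simp
    have dx': "\<forall>s\<in>{0<..<t} - N. (x has_vector_derivative velocity F (x s) (p s)) (at s)"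
      and dp': "\<forall>s\<in>{0<..<t} - N. \<exists>w. w \<in> clarke_gradient (\<lambda>y. max_hamiltonian F y (p s)) (x s) \<and>
        (p has_vector_derivative - w) (at s)"
      using dx dp tT by auto
    obtain \<delta> A where "\<delta> > 0" "A \<ge> 0" and "\<forall>y. norm (y - x t) \<le> \<delta> \<longrightarrow>
      (\<exists>z. trajectory F t (z 0) z \<and> z t = y \<and> (norm (z 0 - x 0))\<^sup>2 \<le> A * (norm (y - x t))\<^sup>2 \<and>
        (- p t) \<bullet> (y - x t) \<le> (- p 0) \<bullet> (z 0 - x 0) + A * (norm (y - x t))\<^sup>2)"
      using backward_comparison[OF F H tT(1) x' p' p0' N dx' dp'] .
    then show ?thesis
      unfolding assms(7) by (rule horizontal_subdifferential_propagates[OF F x0T V[OF t] tT(1) assms(8)])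
  qed
  have zero: "max_hamiltonian F (x t) (p t) = 0" if t: "t \<in> {0..T}" for t
  proof (rule continuous_zero_off_negligible[OF _ T N _ t])
    show "continuous_on {0..T} (\<lambda>s. max_hamiltonian F (x s) (p s))"
      by (rule continuous_on_max_hamiltonian_arc[OF F xc lipschitz_on_continuous_on[OF p]])
    fix s assume s: "s \<in> {0<..<T} - N"
    then have s': "s \<in> {0<..<T}" "s \<in> {0..T}" by auto
    \<comment> \<open>Orthogonality is used at \<open>s\<close> itself, with the costate of that
      time, so it relies on the propagation already achieved in \<open>sub\<close>.\<close>
    have "velocity F (x s) (p s) \<bullet> p s = 0"
      by (rule horizontal_subdifferential_velocity_orthogonal
          [where V = "min_time F K", OF x s'(1) V sub[OF s'(2)] bspec[OF dx s]])
    then show "max_hamiltonian F (x s) (p s) = 0" using velocity(2)[OF F] by simp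
  qed
  show ?thesis
    unfolding T_def[symmetric] using sub zero min_hamiltonian_uminus[OF F] by simp
qed

end
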